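(* Let $q>1$, $0<p<q$, and let $w$ be a weight on $\mathbb{R}^n$ with $w\in RH_{(\frac qp)'}$. Then there is a constant $C$ such that for all sequences of cubes $\{Q_k\}$ and all sequences of non-negative functions $\{g_k\}$ with $\operatorname{supp}(g_k)\subset Q_k$, $$\left\|\sum_k g_k\right\|_{L^p(w)}\le C\left\|\sum_k\left(\frac1{|Q_k|}\int_{Q_k}g_k^q\,dy\right)^{\frac1q}\chi_{Q_k}\right\|_{L^p(w)}.$$
   Context: Cubes have sides parallel to the coordinate axes. A weight is a non-negative locally integrable function $w$ with $0<w<\infty$ a.e. For $1<s<\infty$, $w\in RH_s$ if there is $C$ with $\left(\frac1{|Q|}\int_Q w^s\,dx\right)^{1/s}\le C\,\frac1{|Q|}\int_Q w\,dx$ for every cube $Q$. $s'$ is the conjugate exponent, $\frac1s+\frac1{s'}=1$. $\|f\|_{L^p(w)}=\left(\int_{\mathbb{R}^n}|f|^pw\,dx\right)^{1/p}$. *)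

theory Defs
  imports "HOL-Analysis.Analysis"
begin

text \<open>Weights and the functions they are applied to are non-negative, so all of them, and all
  integrals, take values in \<^typ>\<open>ennreal\<close>; measurability is Lebesgue measurability.\<close>

text \<open>Real powers on \<open>[0,\<infinity>]\<close>, used with exponents \<open>a > 0\<close> only; then \<open>0\<close> and \<open>\<infinity>\<close> are
  mapped to themselves.\<close>

definition epowr :: "ennreal \<Rightarrow> real \<Rightarrow> ennreal"
  where "epowr x a = (if x = \<infinity> then \<infinity> else ennreal (enn2real x powr a))"

text \<open>Cubes are closed and non-degenerate.\<close>

definition cubes :: "(real ^ 'n) set set"
  where "cubes = {cbox a (\<chi> i. a $ i + l) |a l. l > 0}"

definition avg :: "(real ^ 'n) set \<Rightarrow> (real ^ 'n \<Rightarrow> ennreal) \<Rightarrow> ennreal"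
  where "avg Q f = (\<integral>\<^sup>+x\<in>Q. f x \<partial>lebesgue) / emeasure lebesgue Q"

definition weight :: "(real ^ 'n \<Rightarrow> ennreal) \<Rightarrow> bool"
  where "weight w \<longleftrightarrow>
    w \<in> borel_measurable lebesgue \<and>
    (\<forall>K. compact K \<longrightarrow> (\<integral>\<^sup>+x\<in>K. w x \<partial>lebesgue) < \<infinity>) \<and>
    (AE x in lebesgue. 0 < w x \<and> w x < \<infinity>)"

definition RH :: "real \<Rightarrow> (real ^ 'n \<Rightarrow> ennreal) set"
  where "RH s = {w. \<exists>C::real. C > 0 \<and>
    (\<forall>Q\<in>cubes. epowr (avg Q (\<lambda>x. epowr (w x) s)) (1 / s) \<le> ennreal C * avg Q w)}"

definition conj_exponent :: "real \<Rightarrow> real"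
  where "conj_exponent s = s / (s - 1)"

lemma conj_exponent_iff:
  assumes "s > 1"
  shows "1 / s + 1 / t = 1 \<longleftrightarrow> t = conj_exponent s"
proof (cases "t = 0")
  case True
  then show ?thesis using assms by (auto simp: conj_exponent_def)
next
  case False
  then show ?thesis using assms by (auto simp: conj_exponent_def field_simps)
qed

text \<open>The (quasi-)norm of \<open>L\<^sup>p(w)\<close> on non-negative functions, for any \<open>p > 0\<close>; it may be
  infinite.\<close>

definition Lp_norm :: "real \<Rightarrow> (real ^ 'n \<Rightarrow> ennreal) \<Rightarrow> (real ^ 'n \<Rightarrow> ennreal) \<Rightarrow> ennreal"
  where "Lp_norm p w f = epowr (\<integral>\<^sup>+x. epowr (f x) p * w x \<partial>lebesgue) (1 / p)"

end

theory Submission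
  imports Defs
begin

text \<open>Put \<open>s = (q/p)' = q/(q-p)\<close>, and let \<open>d\<sigma> = w\<^sup>s dx\<close> and \<open>\<phi> = w\<^bsup>-1/(q-p)\<^esup>\<close>. These exponents satisfy
  \<open>\<phi>\<^sup>q d\<sigma> = dx\<close> and \<open>\<phi>\<^sup>p d\<sigma> = w dx\<close>. Hence, passing from \<open>g\<^sub>k\<close> to \<open>u\<^sub>k = g\<^sub>k \<phi>\<close>, the left side becomes
  the norm of \<open>\<Sum> u\<^sub>k\<close> in \<open>L\<^sup>p(\<sigma>)\<close>. If \<open>W\<^sub>k\<close> denotes the \<open>L\<^sup>s\<close> average of \<open>w\<close> over \<open>Q\<^sub>k\<close> and \<open>a\<^sub>k\<close> the
  \<open>L\<^sup>q\<close> average of \<open>g\<^sub>k\<close>, the \<open>L\<^sup>q(\<sigma>)\<close> average of \<open>u\<^sub>k\<close> is \<open>b\<^sub>k = W\<^sub>k\<^bsup>-1/(q-p)\<^esup> a\<^sub>k\<close>. This is at most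
  a constant times \<open>a\<^sub>k \<phi>\<close> on the part \<open>E\<^sub>k\<close> of \<open>Q\<^sub>k\<close> where \<open>w\<close> is at most a large multiple of \<open>W\<^sub>k\<close>.

  The reverse Hoelder inequality is used twice: it shows that \<open>E\<^sub>k\<close> carries a fixed proportion of
  \<open>\<sigma>(Q\<^sub>k)\<close> (\<open>core_large\<close>), and that \<open>\<sigma>\<close> is doubling (\<open>\<sigma>_doubling\<close>). It remains to prove, for a doubling
  measure \<open>\<sigma>\<close> without weights, that the norm of \<open>\<Sum> u\<^sub>k\<close> in \<open>L\<^sup>p(\<sigma>)\<close> is at most a constant times that
  of \<open>\<Sum> b\<^sub>k \<chi>\<close> with \<open>\<chi>\<close> the indicator of \<open>E\<^sub>k\<close>.

  Here the tool is the maximal function over the cubes \<open>Q\<^sub>k\<close> themselves. By truncation and monotone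
  convergence finitely many cubes suffice, so that the covering argument is elementary and all
  quantities are finite. For \<open>p > 1\<close> the sum is tested against its own power \<open>(\<Sum> u\<^sub>k)\<^bsup>p-1\<^esup>\<close>, and
  \<open>p < q\<close> is the condition for the maximal theorem (\<open>estimate_gt_1\<close>). For \<open>p < 1\<close>, a
  negative power of a maximal function of the right side takes the role of the test function, and
  reduces the claim to one that is linear in the \<open>u\<^sub>k\<close> (\<open>estimate_lt_1_nonzero\<close>). For \<open>p = 1\<close> the claim
  is immediate.\<close>

section \<open>Hoelder's inequality for non-negative integrals\<close>

text \<open>Young's inequality for \<open>f/A\<close> and \<open>g/B\<close>, integrated. Bounds \<open>A\<close> and \<open>B\<close>
  in place of the integrals themselves keep all powers on the real line, where exponents may be
  negative.\<close>

lemma nn_integral_powr_Holder: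
  fixes f g :: "'a \<Rightarrow> real"
  assumes [measurable]: "f \<in> borel_measurable M" "g \<in> borel_measurable M"
    and nn: "\<And>x. f x \<ge> 0" "\<And>x. g x \<ge> 0"
    and a: "0 < a" "a < 1" and AB: "0 \<le> A" "0 \<le> B"
    and f: "(\<integral>\<^sup>+x. ennreal (f x) \<partial>M) \<le> ennreal A"
    and g: "(\<integral>\<^sup>+x. ennreal (g x) \<partial>M) \<le> ennreal B"
  shows "(\<integral>\<^sup>+x. ennreal (f x powr a * g x powr (1 - a)) \<partial>M) \<le> ennreal (A powr a * B powr (1 - a))"
proof (cases "A = 0 \<or> B = 0")
  case True
  then have "(\<integral>\<^sup>+x. ennreal (f x) \<partial>M) = 0 \<or> (\<integral>\<^sup>+x. ennreal (g x) \<partial>M) = 0"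
    using f g by auto
  then have "(AE x in M. f x = 0) \<or> (AE x in M. g x = 0)"
    using nn by (auto simp: nn_integral_0_iff_AE antisym)
  then have "AE x in M. f x powr a * g x powr (1 - a) = 0"
    by auto
  then have "AE x in M. ennreal (f x powr a * g x powr (1 - a)) = 0"
    by eventually_elim simp
  then have "(\<integral>\<^sup>+x. ennreal (f x powr a * g x powr (1 - a)) \<partial>M) = 0"
    by (subst nn_integral_0_iff_AE) auto
  then show ?thesis by simp
next
  case False
  then have pos: "A > 0" "B > 0" using AB by auto
  define P where "P = A powr a * B powr (1 - a)"
  have P: "P > 0" using pos by (simp add: P_def)
  have young: "f x powr a * g x powr (1 - a) \<le> P * a / A * f x + P * (1 - a) / B * g x" for x
  proof (cases "f x = 0 \<or> g x = 0")
    case True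
    then show ?thesis using nn[of x] P pos a by auto
  next
    case False
    then have fg: "f x > 0" "g x > 0" using nn[of x] by auto
    have "(f x / A) powr a * (g x / B) powr (1 - a) \<le> a * (f x / A) + (1 - a) * (g x / B)"
      by (rule Youngs_inequality_0) (use a fg pos in auto)
    then have "P * ((f x / A) powr a * (g x / B) powr (1 - a)) \<le> P * (a * (f x / A) + (1 - a) * (g x / B))"
      using P by simp
    moreover have "P * ((f x / A) powr a * (g x / B) powr (1 - a)) = f x powr a * g x powr (1 - a)"
      using fg pos by (simp add: P_def powr_divide)
    ultimately show ?thesis by (simp add: algebra_simps)
  qed
  have "(\<integral>\<^sup>+x. ennreal (f x powr a * g x powr (1 - a)) \<partial>M)
      \<le> (\<integral>\<^sup>+x. ennreal (P * a / A) * ennreal (f x) + ennreal (P * (1 - a) / B) * ennreal (g x) \<partial>M)"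
    using P pos a nn young by (intro nn_integral_mono)
      (simp add: ennreal_mult[symmetric] ennreal_plus[symmetric] del: ennreal_plus)
  also have "\<dots> = ennreal (P * a / A) * (\<integral>\<^sup>+x. ennreal (f x) \<partial>M) + ennreal (P * (1 - a) / B) * (\<integral>\<^sup>+x. ennreal (g x) \<partial>M)"
    by (simp add: nn_integral_add nn_integral_cmult)
  also have "\<dots> \<le> ennreal (P * a / A) * ennreal A + ennreal (P * (1 - a) / B) * ennreal B"
    using f g by (intro add_mono mult_left_mono) auto
  also have "\<dots> = ennreal P"
    using P pos a
    by (simp add: ennreal_mult[symmetric] ennreal_plus[symmetric] right_diff_distrib del: ennreal_plus)
  finally show ?thesis by (simp add: P_def)
qed

section \<open>The maximal function of a finite Vitali family\<close>

text \<open>All that the maximal theorem uses of cubes in a doubling measure: any subfamily contains a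
  disjoint one that controls the measure of its union. The sets are given positive finite measure
  so that averages over them are genuine real numbers.\<close>

definition vitali_family :: "'a measure \<Rightarrow> real \<Rightarrow> 'i set \<Rightarrow> ('i \<Rightarrow> 'a set) \<Rightarrow> bool"
  where "vitali_family M D I Q \<longleftrightarrow> finite I \<and> D > 0 \<and>
    (\<forall>k\<in>I. Q k \<in> sets M \<and> 0 < emeasure M (Q k) \<and> emeasure M (Q k) < \<infinity>) \<and>
    (\<forall>J\<subseteq>I. \<exists>J'\<subseteq>J. disjoint_family_on Q J' \<and>
       emeasure M (\<Union>k\<in>J. Q k) \<le> ennreal D * (\<Sum>k\<in>J'. emeasure M (Q k)))"

text \<open>When \<open>m k\<close> is the average of \<open>f\<close> over \<open>Q k\<close>, this is the maximal function of \<open>f\<close> restricted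
  to the given finite family, with value \<open>0\<close> off the sets; being a simple function, it has finite
  \<open>L\<^sup>r\<close> norms.\<close>

definition max_fun :: "'i set \<Rightarrow> ('i \<Rightarrow> 'a set) \<Rightarrow> ('i \<Rightarrow> real) \<Rightarrow> 'a \<Rightarrow> real"
  where "max_fun I Q m x = Max (insert 0 ((\<lambda>k. m k * indicator (Q k) x) ` I))"

lemma max_fun_nonneg: "finite I \<Longrightarrow> 0 \<le> max_fun I Q m x"
  by (simp add: max_fun_def)

lemma max_fun_ge: "finite I \<Longrightarrow> k \<in> I \<Longrightarrow> x \<in> Q k \<Longrightarrow> m k \<le> max_fun I Q m x"
  unfolding max_fun_def by (intro Max_ge) (auto simp: image_iff intro!: bexI[of _ k])

lemma less_max_fun_iff:
  "finite I \<Longrightarrow> 0 \<le> t \<Longrightarrow> t < max_fun I Q m x \<longleftrightarrow> (\<exists>k\<in>I. t < m k \<and> x \<in> Q k)"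
  unfolding max_fun_def by (subst Max_gr_iff) (auto simp: indicator_def split: if_splits)

lemma max_fun_le:
  "finite I \<Longrightarrow> 0 \<le> t \<Longrightarrow> (\<And>k. k \<in> I \<Longrightarrow> x \<in> Q k \<Longrightarrow> m k \<le> t) \<Longrightarrow> max_fun I Q m x \<le> t"
  using less_max_fun_iff[of I t Q m x] by (meson not_le)

lemma max_fun_measurable [measurable]:
  assumes "finite I" "\<And>k. k \<in> I \<Longrightarrow> Q k \<in> sets M"
  shows "max_fun I Q m \<in> borel_measurable M"
proof -
  have "max_fun I Q m = (\<lambda>x. Max ((\<lambda>i. case i of None \<Rightarrow> 0 | Some k \<Rightarrow> m k * indicator (Q k) x) ` (insert None (Some ` I))))"
    by (auto simp: max_fun_def image_image)
  also have "\<dots> \<in> borel_measurable M"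
    using assms by (intro borel_measurable_Max) (auto split: option.splits)
  finally show ?thesis .
qed

text \<open>The set where the maximal function exceeds \<open>t\<close> is the union of the \<open>Q k\<close> with \<open>m k > t\<close>. On each
  member of a disjoint subfamily that controls this union, \<open>t\<close> times the measure is at most the
  integral of \<open>f\<close>. Keeping that integral restricted to the level set, as in Doob's
  inequality, is what makes the passage to \<open>L\<^sup>r\<close> possible.\<close>

lemma weak_type_max_fun:
  assumes V: "vitali_family M D I Q" and t: "t > 0"
    and f[measurable]: "f \<in> borel_measurable M"
    and m: "\<And>k. k \<in> I \<Longrightarrow> ennreal (m k) * emeasure M (Q k) \<le> (\<integral>\<^sup>+x. f x * indicator (Q k) x \<partial>M)"
  shows "ennreal t * emeasure M {x\<in>space M. t < max_fun I Q m x}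
       \<le> ennreal D * (\<integral>\<^sup>+x. f x * indicator {x\<in>space M. t < max_fun I Q m x} x \<partial>M)"
proof -
  define J where "J = {k\<in>I. t < m k}"
  have fin: "finite I" and sets: "\<And>k. k \<in> I \<Longrightarrow> Q k \<in> sets M" using V by (auto simp: vitali_family_def)
  have sp: "\<And>k. k \<in> I \<Longrightarrow> Q k \<subseteq> space M" using sets sets.sets_into_space by auto
  have U: "{x\<in>space M. t < max_fun I Q m x} = (\<Union>k\<in>J. Q k)"
    using less_max_fun_iff[of I t Q m] fin t sp by (auto simp: J_def)
  obtain J' where J': "J' \<subseteq> J" "disjoint_family_on Q J'"
    and le: "emeasure M (\<Union>k\<in>J. Q k) \<le> ennreal D * (\<Sum>k\<in>J'. emeasure M (Q k))"
    using V unfolding vitali_family_def J_def by (metis (no_types, lifting) mem_Collect_eq subsetI)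
  have finJ': "finite J'" using J' fin by (auto simp: J_def intro: finite_subset)
  have sJ': "\<And>k. k \<in> J' \<Longrightarrow> Q k \<in> sets M" using J' sets by (auto simp: J_def)
  have "ennreal t * emeasure M (\<Union>k\<in>J. Q k) \<le> ennreal t * (ennreal D * (\<Sum>k\<in>J'. emeasure M (Q k)))"
    using le by (intro mult_left_mono) auto
  also have "\<dots> = ennreal D * (\<Sum>k\<in>J'. ennreal t * emeasure M (Q k))"
    by (simp add: sum_distrib_left mult_ac)
  also have "\<dots> \<le> ennreal D * (\<Sum>k\<in>J'. (\<integral>\<^sup>+x. f x * indicator (Q k) x \<partial>M))"
  proof (intro mult_left_mono sum_mono)
    fix k assume k: "k \<in> J'"
    then have "ennreal t * emeasure M (Q k) \<le> ennreal (m k) * emeasure M (Q k)"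
      using J' t by (intro mult_right_mono ennreal_leI) (auto simp: J_def)
    also have "\<dots> \<le> (\<integral>\<^sup>+x. f x * indicator (Q k) x \<partial>M)"
      using k J' by (intro m) (auto simp: J_def)
    finally show "ennreal t * emeasure M (Q k) \<le> (\<integral>\<^sup>+x. f x * indicator (Q k) x \<partial>M)" .
  qed auto
  also have "(\<Sum>k\<in>J'. (\<integral>\<^sup>+x. f x * indicator (Q k) x \<partial>M)) = (\<integral>\<^sup>+x. f x * (\<Sum>k\<in>J'. indicator (Q k) x) \<partial>M)"
    using sJ' by (subst nn_integral_sum[symmetric]) (auto simp: sum_distrib_left)
  also have "\<dots> = (\<integral>\<^sup>+x. f x * indicator (\<Union>k\<in>J'. Q k) x \<partial>M)"
    using J' finJ' by (simp add: indicator_UN_disjoint)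
  also have "\<dots> \<le> (\<integral>\<^sup>+x. f x * indicator (\<Union>k\<in>J. Q k) x \<partial>M)"
    using J' by (intro nn_integral_mono mult_left_mono) (auto simp: indicator_def)
  finally show ?thesis unfolding U by (simp add: mult_left_mono)
qed

text \<open>A layer-cake formula over the dyadic levels \<open>A, A/2, A/4, ...\<close>. The largest level below \<open>2 t\<close>
  is at least \<open>t\<close>, so its own term dominates \<open>t\<^sup>r\<close>; conversely the levels below \<open>2 t\<close> form a geometric
  series comparable to its largest term.\<close>

lemma dyadic_power_le_suminf:
  fixes t A r :: real
  assumes "0 < t" "t \<le> A" "0 < r"
  shows "ennreal (t powr r) \<le> (\<Sum>j. ennreal ((A / 2 ^ j) powr r) * indicator {j. A / 2 ^ j / 2 < t} j)"
proof -
  obtain n where n: "A / t < 2 ^ n" using real_arch_pow[of 2 "A / t"] by auto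
  define j where "j = (LEAST j. A / 2 ^ j / 2 < t)"
  have "A / 2 ^ n / 2 \<le> A / 2 ^ n" using assms by (simp add: field_simps)
  also have "\<dots> < t" using n assms by (simp add: field_simps)
  finally have ex: "A / 2 ^ n / 2 < t" .
  have j: "A / 2 ^ j / 2 < t" unfolding j_def by (rule LeastI[of _ n]) (rule ex)
  have ge: "t \<le> A / 2 ^ j"
  proof (cases j)
    case (Suc i)
    then have "\<not> A / 2 ^ i / 2 < t" unfolding j_def using not_less_Least by (metis lessI)
    then show ?thesis using Suc by (simp add: field_simps)
  qed (use assms in simp)
  define h where "h j = ennreal ((A / 2 ^ j) powr r) * indicator {j. A / 2 ^ j / 2 < t} j" for j
  have "ennreal (t powr r) \<le> h j"
    using ge assms j by (auto simp: h_def intro!: ennreal_leI powr_mono2)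
  also have "\<dots> \<le> (\<Sum>j. h j)"
    using sum_le_suminf[of h "{j}"] by simp
  finally show ?thesis by (simp add: h_def)
qed

lemma suminf_dyadic_power_le:
  fixes t A e :: real
  assumes t: "0 \<le> t" and A: "0 < A" and e: "0 < e"
  shows "(\<Sum>j. ennreal ((A / 2 ^ j) powr e) * indicator {j. A / 2 ^ j / 2 < t} j)
      \<le> ennreal (2 powr e / (1 - 2 powr (- e)) * t powr e)"
proof (cases "t = 0")
  case True
  then have "indicator {j. A / 2 ^ j / 2 < t} j = (0::ennreal)" for j :: nat
    using A by (simp add: indicator_def not_less)
  then show ?thesis using True by simp
next
  case False
  then have t: "t > 0" using t by simp
  obtain n where n: "A / t < 2 ^ n" using real_arch_pow[of 2 "A / t"] by auto
  define j0 where "j0 = (LEAST j. A / 2 ^ j / 2 < t)"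
  have "A / 2 ^ n / 2 \<le> A / 2 ^ n" using A by (simp add: field_simps)
  also have "\<dots> < t" using n t by (simp add: field_simps)
  finally have ex: "A / 2 ^ n / 2 < t" .
  have j0: "A / 2 ^ j0 / 2 < t" unfolding j0_def by (rule LeastI[of _ n]) (rule ex)
  define c where "c = (2::real) powr (- e)"
  have c: "0 < c" "c < 1" using e powr_less_mono[of "-e" 0 2] by (auto simp: c_def)
  define h where "h j = (if j < j0 then 0 else (2 * t) powr e * c ^ (j - j0))" for j
  have "(\<lambda>i. (2 * t) powr e * c ^ i) sums ((2 * t) powr e * (1 / (1 - c)))"
    using c by (intro sums_mult geometric_sums) auto
  then have "h sums ((2 * t) powr e * (1 / (1 - c)))"
    using sums_zero_iff_shift[of j0 h] by (simp add: h_def[abs_def])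
  moreover have h0: "h j \<ge> 0" for j using c by (simp add: h_def)
  ultimately have S: "(\<Sum>j. ennreal (h j)) = ennreal ((2 * t) powr e * (1 / (1 - c)))"
    by (simp add: suminf_ennreal2 sums_iff)
  have "(\<Sum>j. ennreal ((A / 2 ^ j) powr e) * indicator {j. A / 2 ^ j / 2 < t} j) \<le> (\<Sum>j. ennreal (h j))"
  proof (rule suminf_le)
    fix j
    show "ennreal ((A / 2 ^ j) powr e) * indicator {j. A / 2 ^ j / 2 < t} j \<le> ennreal (h j)"
    proof (cases "A / 2 ^ j / 2 < t")
      case True
      then have "j0 \<le> j" unfolding j0_def by (rule Least_le)
      then obtain i where i: "j = j0 + i" using le_Suc_ex by blast
      have "A / 2 ^ j = A / 2 ^ j0 / 2 ^ i" by (simp add: i power_add)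
      also have "\<dots> \<le> 2 * t / 2 ^ i" using j0 by (intro divide_right_mono) auto
      finally have "(A / 2 ^ j) powr e \<le> (2 * t / 2 ^ i) powr e"
        using A e by (intro powr_mono2) auto
      also have "\<dots> = (2 * t) powr e * c ^ i"
        using t by (simp add: powr_divide c_def powr_minus inverse_eq_divide power_divide
            powr_realpow[symmetric] powr_powr mult.commute)
      finally show ?thesis using True i by (auto simp: h_def intro: ennreal_leI)
    qed simp
  qed auto
  also have "\<dots> = ennreal (2 powr e / (1 - 2 powr (- e)) * t powr e)"
    unfolding S c_def using t by (simp add: powr_mult)
  finally show ?thesis .
qed

text \<open>Turns an estimate that contains the quantity to be bounded on both sides into a bound for it.
  The finiteness of \<open>X\<close>, which makes the cancellation legitimate, is in its type.\<close>

lemma powr_absorb: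
  fixes X Y L a :: real
  assumes "0 \<le> X" "0 \<le> Y" "0 \<le> L" "0 < a" "X \<le> L * (Y powr a * X powr (1 - a))"
  shows "X \<le> L powr (1 / a) * Y"
proof (cases "X = 0")
  case False
  then have X: "X > 0" using assms by simp
  have "X powr a * X powr (1 - a) = X" using X by (simp add: powr_add[symmetric])
  then have "X powr a * X powr (1 - a) \<le> (L * Y powr a) * X powr (1 - a)"
    using assms(5) by (simp add: mult_ac)
  then have "X powr a \<le> L * Y powr a" using X by simp
  then have "(X powr a) powr (1 / a) \<le> (L * Y powr a) powr (1 / a)"
    using assms by (intro powr_mono2) auto
  then show ?thesis using assms X by (simp add: powr_mult powr_powr)
qed (use assms in simp)

definition maximal_const :: "real \<Rightarrow> real \<Rightarrow> real"
  where "maximal_const D r = (2 * D * (2 powr (r - 1) / (1 - 2 powr (- (r - 1))))) powr r"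

lemma maximal_const_pos: "D > 0 \<Longrightarrow> r > 1 \<Longrightarrow> maximal_const D r > 0"
  using powr_less_mono[of "-(r-1)" 0 2] by (simp add: maximal_const_def)

text \<open>Summing the weak type inequality over dyadic levels gives a bound of \<open>\<integral> T\<^sup>r\<close> by
  \<open>\<integral> f T\<^bsup>r-1\<^esup>\<close>, where \<open>T\<close> is the maximal function. Hoelder's inequality then bounds the latter by
  \<open>(\<integral> f\<^sup>r)\<^bsup>1/r\<^esup> (\<integral> T\<^sup>r)\<^bsup>1-1/r\<^esup>\<close>, and the last factor is absorbed.\<close>

lemma strong_type_max_fun:
  fixes f :: "'a \<Rightarrow> real"
  assumes V: "vitali_family M D I Q" and r: "r > 1"
    and f[measurable]: "f \<in> borel_measurable M" and f0: "\<And>x. f x \<ge> 0"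
    and m: "\<And>k. k \<in> I \<Longrightarrow> ennreal (m k) * emeasure M (Q k) \<le> (\<integral>\<^sup>+x. ennreal (f x) * indicator (Q k) x \<partial>M)"
    and Y: "0 \<le> Y" "(\<integral>\<^sup>+x. ennreal (f x powr r) \<partial>M) \<le> ennreal Y"
  shows "(\<integral>\<^sup>+x. ennreal (max_fun I Q m x powr r) \<partial>M)
       \<le> ennreal (maximal_const D r * Y)"
proof -
  define T where "T = max_fun I Q m"
  have fin: "finite I" and D: "D > 0" and sets: "\<And>k. k \<in> I \<Longrightarrow> Q k \<in> sets M"
    and Qfin: "\<And>k. k \<in> I \<Longrightarrow> emeasure M (Q k) < \<infinity>" using V by (auto simp: vitali_family_def)
  have [measurable]: "T \<in> borel_measurable M" unfolding T_def using fin sets by (rule max_fun_measurable)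
  have T0: "T x \<ge> 0" for x using fin by (simp add: T_def max_fun_nonneg)
  \<comment> \<open>The top dyadic level has to bound the maximal function; adding 1 makes it positive.\<close>
  define A where "A = 1 + (\<Sum>k\<in>I. \<bar>m k\<bar>)"
  have A: "A > 0" by (simp add: A_def sum_nonneg add_pos_nonneg)
  have TA: "T x \<le> A" for x
  proof -
    have "m k \<le> A" if "k \<in> I" for k
      using member_le_sum[of k I "\<lambda>k. \<bar>m k\<bar>"] that fin by (auto simp: A_def)
    then show ?thesis unfolding T_def using fin A by (intro max_fun_le) auto
  qed
  define C where "C = 2 powr (r - 1) / (1 - 2 powr (- (r - 1)))"
  have C: "C \<ge> 0" using r powr_less_mono[of "-(r-1)" 0 2] by (auto simp: C_def)
  define L where "L = 2 * D * C"
  have L: "L \<ge> 0" using C D by (simp add: L_def)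
  define S where "S j = {x\<in>space M. A / 2 ^ j / 2 < T x}" for j :: nat
  have [measurable]: "S j \<in> sets M" for j unfolding S_def by measurable
  have indS: "x \<in> space M \<Longrightarrow> indicator {j. A / 2 ^ j / 2 < T x} j = (indicator (S j) x :: ennreal)" for x j
    by (simp add: S_def indicator_def)

  have "(\<integral>\<^sup>+x. ennreal (T x powr r) \<partial>M)
      \<le> (\<integral>\<^sup>+x. (\<Sum>j. ennreal ((A / 2 ^ j) powr r) * indicator (S j) x) \<partial>M)"
  proof (rule nn_integral_mono)
    fix x assume x: "x \<in> space M"
    show "ennreal (T x powr r) \<le> (\<Sum>j. ennreal ((A / 2 ^ j) powr r) * indicator (S j) x)"
    proof (cases "T x = 0")
      case False
      then have "T x > 0" using T0[of x] by simp
      then show ?thesis using dyadic_power_le_suminf[of "T x" A r] TA r unfolding indS[OF x] by simp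
    qed simp
  qed
  also have "\<dots> = (\<Sum>j. ennreal ((A / 2 ^ j) powr r) * emeasure M (S j))"
    by (subst nn_integral_suminf) (auto simp: nn_integral_cmult)
  also have "\<dots> \<le> (\<Sum>j. ennreal (2 * D) * (\<integral>\<^sup>+x. ennreal (f x) * (ennreal ((A / 2 ^ j) powr (r - 1)) * indicator (S j) x) \<partial>M))"
  proof (rule suminf_le)
    fix j :: nat
    let ?a = "A / 2 ^ j"
    have a: "?a > 0" using A by simp
    have "?a powr r = (2 * ?a powr (r - 1)) * (?a / 2)"
      using a A by (simp add: powr_diff)
    then have "ennreal (?a powr r) * emeasure M (S j) = ennreal (2 * ?a powr (r - 1)) * (ennreal (?a / 2) * emeasure M (S j))"
      using a by (simp add: ennreal_mult[symmetric] mult.assoc[symmetric])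
    also have "\<dots> \<le> ennreal (2 * ?a powr (r - 1)) * (ennreal D * (\<integral>\<^sup>+x. ennreal (f x) * indicator (S j) x \<partial>M))"
      unfolding S_def T_def using V a m by (intro mult_left_mono weak_type_max_fun) auto
    also have "\<dots> = ennreal (2 * D) * (ennreal (?a powr (r - 1)) * (\<integral>\<^sup>+x. ennreal (f x) * indicator (S j) x \<partial>M))"
      using D by (simp add: ennreal_mult mult_ac)
    also have "\<dots> = ennreal (2 * D) * (\<integral>\<^sup>+x. ennreal (f x) * (ennreal (?a powr (r - 1)) * indicator (S j) x) \<partial>M)"
      by (subst nn_integral_cmult[symmetric]) (auto simp: mult_ac)
    finally show "ennreal (?a powr r) * emeasure M (S j) \<le> \<dots>" .
  qed auto
  also have "\<dots> = ennreal (2 * D) * (\<integral>\<^sup>+x. ennreal (f x) * (\<Sum>j. ennreal ((A / 2 ^ j) powr (r - 1)) * indicator (S j) x) \<partial>M)"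
    by (subst ennreal_suminf_cmult, subst nn_integral_suminf[symmetric]) (auto simp: ennreal_suminf_cmult)
  also have "\<dots> \<le> ennreal (2 * D) * (\<integral>\<^sup>+x. ennreal (f x) * ennreal (C * T x powr (r - 1)) \<partial>M)"
  proof (intro mult_left_mono nn_integral_mono)
    fix x assume x: "x \<in> space M"
    show "(\<Sum>j. ennreal ((A / 2 ^ j) powr (r - 1)) * indicator (S j) x) \<le> ennreal (C * T x powr (r - 1))"
      using suminf_dyadic_power_le[of "T x" A "r - 1"] T0 A r unfolding indS[OF x] C_def by simp
  qed auto
  also have "\<dots> = ennreal L * (\<integral>\<^sup>+x. ennreal ((f x powr r) powr (1 / r) * (T x powr r) powr (1 - 1 / r)) \<partial>M)"
  proof -
    have "ennreal (f x) * ennreal (C * T x powr (r - 1)) = ennreal C * ennreal ((f x powr r) powr (1 / r) * (T x powr r) powr (1 - 1 / r))" for x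
    proof -
      have "r * (1 - 1 / r) = r - 1" using r by (simp add: field_simps)
      then show ?thesis using r f0[of x] C by (simp add: powr_powr ennreal_mult[symmetric] mult_ac)
    qed
    then show ?thesis using C D
      by (simp add: nn_integral_cmult L_def ennreal_mult mult.assoc)
  qed
  finally have main: "(\<integral>\<^sup>+x. ennreal (T x powr r) \<partial>M)
     \<le> ennreal L * (\<integral>\<^sup>+x. ennreal ((f x powr r) powr (1 / r) * (T x powr r) powr (1 - 1 / r)) \<partial>M)" .

  have "(\<integral>\<^sup>+x. ennreal (T x powr r) \<partial>M) \<le> (\<integral>\<^sup>+x. ennreal (A powr r) * indicator (\<Union>k\<in>I. Q k) x \<partial>M)"
  proof (rule nn_integral_mono)
    fix x
    show "ennreal (T x powr r) \<le> ennreal (A powr r) * indicator (\<Union>k\<in>I. Q k) x"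
    proof (cases "T x = 0")
      case False
      then have "T x > 0" using T0[of x] by simp
      then have "\<exists>k\<in>I. x \<in> Q k" using less_max_fun_iff[of I 0 Q m x] fin by (auto simp: T_def)
      then show ?thesis using TA[of x] T0[of x] r by (auto simp: indicator_def intro!: ennreal_leI powr_mono2)
    qed simp
  qed
  also have "\<dots> = ennreal (A powr r) * emeasure M (\<Union>k\<in>I. Q k)"
    using sets fin by (intro nn_integral_cmult_indicator) auto
  also have "\<dots> \<le> ennreal (A powr r) * (\<Sum>k\<in>I. emeasure M (Q k))"
    using sets fin by (intro mult_left_mono emeasure_subadditive_finite) auto
  also have "\<dots> < \<infinity>" using Qfin fin by (simp add: ennreal_mult_less_top)
  finally obtain X where X: "0 \<le> X" "(\<integral>\<^sup>+x. ennreal (T x powr r) \<partial>M) = ennreal X"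
    by (cases "(\<integral>\<^sup>+x. ennreal (T x powr r) \<partial>M)") auto
  have "(\<integral>\<^sup>+x. ennreal ((f x powr r) powr (1 / r) * (T x powr r) powr (1 - 1 / r)) \<partial>M)
      \<le> ennreal (Y powr (1 / r) * X powr (1 - 1 / r))"
    using X Y r by (intro nn_integral_powr_Holder) auto
  then have "ennreal X \<le> ennreal L * ennreal (Y powr (1 / r) * X powr (1 - 1 / r))"
    using main X by (metis (no_types, lifting) mult_left_mono order_trans zero_le)
  then have "X \<le> L * (Y powr (1 / r) * X powr (1 - 1 / r))"
    using L by (simp add: ennreal_mult[symmetric])
  then have "X \<le> L powr (1 / (1 / r)) * Y"
    using X Y L r by (intro powr_absorb) auto
  then show ?thesis using X(2) by (auto simp: maximal_const_def L_def C_def T_def intro: ennreal_leI)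
qed

section \<open>Sums of blocks in a measure with a Vitali property\<close>

lemma vitali_family_subset:
  "vitali_family M D I Q \<Longrightarrow> J \<subseteq> I \<Longrightarrow> vitali_family M D J Q"
  unfolding vitali_family_def by (meson finite_subset order_trans subsetD)

lemma real_average_times:
  fixes a s :: ennreal
  assumes "a < \<infinity>" "0 < s" "s < \<infinity>"
  shows "ennreal (enn2real a / enn2real s) * s = a"
proof -
  obtain x y where "a = ennreal x" "x \<ge> 0" "s = ennreal y" "y \<ge> 0"
    using assms by (cases a; cases s) auto
  then show ?thesis using assms by (simp add: ennreal_mult[symmetric])
qed

text \<open>Hoelder's inequality for averages over \<open>A\<close>, with \<open>f\<close> in the role of the \<open>q'\<close>-th power
  of the second factor.\<close>

lemma Holder_averages:
  fixes u f :: "'a \<Rightarrow> real"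
  assumes [measurable]: "u \<in> borel_measurable M" "f \<in> borel_measurable M" "A \<in> sets M"
    and nn: "\<And>x. u x \<ge> 0" "\<And>x. f x \<ge> 0" and q: "q > 1" and bm: "b \<ge> 0" "m \<ge> 0"
    and A: "emeasure M A < \<infinity>" and supp: "\<And>x. x \<notin> A \<Longrightarrow> u x = 0"
    and u: "(\<integral>\<^sup>+x. ennreal (u x powr q) \<partial>M) \<le> ennreal (b powr q) * emeasure M A"
    and f: "(\<integral>\<^sup>+x. ennreal (f x) * indicator A x \<partial>M) \<le> ennreal m * emeasure M A"
  shows "(\<integral>\<^sup>+x. ennreal (u x * f x powr (1 - 1 / q)) \<partial>M) \<le> ennreal (b * m powr (1 - 1 / q)) * emeasure M A"
proof -
  obtain s where s: "s \<ge> 0" "emeasure M A = ennreal s" using A by (cases "emeasure M A") auto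
  have "(\<integral>\<^sup>+x. ennreal (u x * f x powr (1 - 1 / q)) \<partial>M)
      = (\<integral>\<^sup>+x. ennreal ((u x powr q) powr (1 / q) * (f x * indicator A x) powr (1 - 1 / q)) \<partial>M)"
  proof (rule nn_integral_cong)
    fix x show "ennreal (u x * f x powr (1 - 1 / q)) = ennreal ((u x powr q) powr (1 / q) * (f x * indicator A x) powr (1 - 1 / q))"
      using supp[of x] nn[of x] q by (cases "x \<in> A") (auto simp: powr_powr)
  qed
  also have "\<dots> \<le> ennreal ((b powr q * s) powr (1 / q) * (m * s) powr (1 - 1 / q))"
  proof (rule nn_integral_powr_Holder)
    show "(\<integral>\<^sup>+x. ennreal (u x powr q) \<partial>M) \<le> ennreal (b powr q * s)"
      using u s by (simp add: ennreal_mult)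
    show "(\<integral>\<^sup>+x. ennreal (f x * indicator A x) \<partial>M) \<le> ennreal (m * s)"
      using f s bm nn by (simp add: ennreal_mult ennreal_indicator)
  qed (use nn q bm s in auto)
  also have "(b powr q * s) powr (1 / q) * (m * s) powr (1 - 1 / q) = b * m powr (1 - 1 / q) * s"
  proof (cases "s = 0")
    case False
    then have "s powr (1 / q) * s powr (1 - 1 / q) = s" using s by (simp add: powr_add[symmetric])
    then show ?thesis using s bm q by (simp add: powr_mult powr_powr)
  qed simp
  also have "ennreal \<dots> = ennreal (b * m powr (1 - 1 / q)) * emeasure M A"
    using s bm by (simp add: ennreal_mult)
  finally show ?thesis .
qed

lemma bounded_integral_finite:
  assumes "\<And>x. h x \<le> B" "A \<in> sets M" "emeasure M A < \<infinity>"
  shows "(\<integral>\<^sup>+x. ennreal (h x) * indicator A x \<partial>M) < \<infinity>"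
proof -
  have "(\<integral>\<^sup>+x. ennreal (h x) * indicator A x \<partial>M) \<le> (\<integral>\<^sup>+x. ennreal B * indicator A x \<partial>M)"
    using assms(1) by (intro nn_integral_mono mult_right_mono ennreal_leI) auto
  also have "\<dots> = ennreal B * emeasure M A" using assms by (intro nn_integral_cmult_indicator)
  also have "\<dots> < \<infinity>" using assms by (simp add: ennreal_mult_less_top)
  finally show ?thesis .
qed

text \<open>The unweighted form of the problem: blocks \<open>u k\<close> on sets \<open>Q k\<close>, with \<open>b k\<close> an upper bound for
  the \<open>L\<^sup>q\<close> average of \<open>u k\<close>. The comparison function \<open>F\<close> charges \<open>b k\<close> only on a part \<open>E k\<close> of \<open>Q k\<close> that
  carries a fixed proportion of its measure; this slack is what makes it possible to pass from a
  weight to a measure. The bound \<open>N\<close> makes the integrals finite, so that terms can be absorbed.\<close>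

locale block_family =
  fixes M :: "'a measure" and D c q :: real and I :: "'i set" and Q E :: "'i \<Rightarrow> 'a set"
    and u :: "'i \<Rightarrow> 'a \<Rightarrow> real" and b :: "'i \<Rightarrow> real" and N :: real
  assumes vitali: "vitali_family M D I Q"
    and c: "c > 0" and q: "q > 1"
    and E_sets: "k \<in> I \<Longrightarrow> E k \<in> sets M" and E_sub: "k \<in> I \<Longrightarrow> E k \<subseteq> Q k"
    and E_large: "k \<in> I \<Longrightarrow> ennreal c * emeasure M (Q k) \<le> emeasure M (E k)"
    and u_meas: "k \<in> I \<Longrightarrow> u k \<in> borel_measurable M"
    and u_nonneg: "k \<in> I \<Longrightarrow> 0 \<le> u k x" and u_le: "k \<in> I \<Longrightarrow> u k x \<le> N"
    and u_supp: "k \<in> I \<Longrightarrow> x \<notin> Q k \<Longrightarrow> u k x = 0"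
    and b_nonneg: "k \<in> I \<Longrightarrow> 0 \<le> b k"
    and u_size: "k \<in> I \<Longrightarrow> (\<integral>\<^sup>+x. ennreal (u k x powr q) \<partial>M) \<le> ennreal (b k powr q) * emeasure M (Q k)"
begin

definition G :: "'a \<Rightarrow> real" where "G x = (\<Sum>k\<in>I. u k x)"
definition F :: "'a \<Rightarrow> real" where "F x = (\<Sum>k\<in>I. b k * indicator (E k) x)"

lemma fin: "finite I" and D_pos: "D > 0"
  using vitali by (auto simp: vitali_family_def)

lemma Q_sets: "k \<in> I \<Longrightarrow> Q k \<in> sets M" and Q_pos: "k \<in> I \<Longrightarrow> 0 < emeasure M (Q k)"
  and Q_fin: "k \<in> I \<Longrightarrow> emeasure M (Q k) < \<infinity>"
  using vitali by (auto simp: vitali_family_def)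

lemma G_meas [measurable]: "G \<in> borel_measurable M"
  unfolding G_def[abs_def] by (intro borel_measurable_sum u_meas)

lemma F_meas [measurable]: "F \<in> borel_measurable M"
  unfolding F_def[abs_def] using E_sets by (intro borel_measurable_sum) auto

lemma G_nonneg: "0 \<le> G x" unfolding G_def by (intro sum_nonneg u_nonneg)
lemma F_nonneg: "0 \<le> F x" unfolding F_def using b_nonneg by (intro sum_nonneg) auto

lemma b_le_F: "k \<in> I \<Longrightarrow> x \<in> E k \<Longrightarrow> b k \<le> F x"
  unfolding F_def using fin b_nonneg member_le_sum[of k I "\<lambda>k. b k * indicator (E k) x"] by auto

lemma G_supp: "x \<notin> (\<Union>k\<in>I. Q k) \<Longrightarrow> G x = 0"
  unfolding G_def using u_supp by (intro sum.neutral) auto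

lemma F_supp: "x \<notin> (\<Union>k\<in>I. Q k) \<Longrightarrow> F x = 0"
  unfolding F_def using E_sub by (intro sum.neutral) (auto simp: indicator_def)

lemma G_le: "G x \<le> real (card I) * \<bar>N\<bar>"
  unfolding G_def by (intro sum_bounded_above) (use u_le abs_ge_self order_trans in blast)

lemma F_le: "F x \<le> (\<Sum>k\<in>I. b k)"
  unfolding F_def using b_nonneg by (intro sum_mono) (auto simp: indicator_def)

lemma union_fin: "emeasure M (\<Union>k\<in>I. Q k) < \<infinity>"
proof -
  have "emeasure M (\<Union>k\<in>I. Q k) \<le> (\<Sum>k\<in>I. emeasure M (Q k))"
    using Q_sets fin by (intro emeasure_subadditive_finite) auto
  also have "\<dots> < \<infinity>" using Q_fin fin by simp
  finally show ?thesis .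
qed

lemma G_int_finite:
  assumes "p > 0" shows "(\<integral>\<^sup>+x. ennreal (G x powr p) \<partial>M) < \<infinity>"
proof -
  have "(\<integral>\<^sup>+x. ennreal (G x powr p) \<partial>M) = (\<integral>\<^sup>+x. ennreal (G x powr p) * indicator (\<Union>k\<in>I. Q k) x \<partial>M)"
    using G_supp by (intro nn_integral_cong) (auto simp: indicator_def)
  also have "\<dots> < \<infinity>"
    using union_fin Q_sets fin assms G_le G_nonneg
    by (intro bounded_integral_finite[where B = "(real (card I) * \<bar>N\<bar>) powr p"] powr_mono2) auto
  finally show ?thesis .
qed

lemma F_int_finite:
  assumes "p > 0" shows "(\<integral>\<^sup>+x. ennreal (F x powr p) \<partial>M) < \<infinity>"
proof -
  have "(\<integral>\<^sup>+x. ennreal (F x powr p) \<partial>M) = (\<integral>\<^sup>+x. ennreal (F x powr p) * indicator (\<Union>k\<in>I. Q k) x \<partial>M)"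
    using F_supp by (intro nn_integral_cong) (auto simp: indicator_def)
  also have "\<dots> < \<infinity>"
    using union_fin Q_sets fin assms F_le F_nonneg
    by (intro bounded_integral_finite[where B = "(\<Sum>k\<in>I. b k) powr p"] powr_mono2) auto
  finally show ?thesis .
qed

lemma sum_integral_G:
  assumes "h \<in> borel_measurable M" "\<And>x. 0 \<le> h x"
  shows "(\<integral>\<^sup>+x. ennreal (G x * h x) \<partial>M) = (\<Sum>k\<in>I. \<integral>\<^sup>+x. ennreal (u k x * h x) \<partial>M)"
  using assms u_meas u_nonneg
  by (subst nn_integral_sum[symmetric]) (auto simp: G_def sum_distrib_right sum_ennreal intro!: nn_integral_cong)

lemma sum_integral_F:
  assumes "h \<in> borel_measurable M" "\<And>x. 0 \<le> h x"
  shows "(\<integral>\<^sup>+x. ennreal (F x * h x) \<partial>M) = (\<Sum>k\<in>I. \<integral>\<^sup>+x. ennreal (b k * h x) * indicator (E k) x \<partial>M)"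
proof -
  have "ennreal (F x * h x) = (\<Sum>k\<in>I. ennreal (b k * h x) * indicator (E k) x)" for x
  proof -
    have "F x * h x = (\<Sum>k\<in>I. b k * h x * indicator (E k) x)"
      unfolding F_def sum_distrib_right by (simp add: mult_ac)
    also have "ennreal \<dots> = (\<Sum>k\<in>I. ennreal (b k * h x * indicator (E k) x))"
      using b_nonneg assms by (intro sum_ennreal[symmetric]) auto
    also have "\<dots> = (\<Sum>k\<in>I. ennreal (b k * h x) * indicator (E k) x)"
      by (intro sum.cong) (auto simp: indicator_def)
    finally show ?thesis .
  qed
  then show ?thesis using assms E_sets by (subst nn_integral_sum[symmetric]) auto
qed

lemma u_integral_le: "k \<in> I \<Longrightarrow> (\<integral>\<^sup>+x. ennreal (u k x) \<partial>M) \<le> ennreal (b k) * emeasure M (Q k)"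
  using Holder_averages[of "u k" M "\<lambda>_. 1" "Q k" q "b k" 1] u_meas Q_sets u_nonneg q b_nonneg Q_fin u_supp u_size
  by auto

lemma estimate_eq_1: "(\<integral>\<^sup>+x. ennreal (G x) \<partial>M) \<le> ennreal (1 / c) * (\<integral>\<^sup>+x. ennreal (F x) \<partial>M)"
proof -
  have "(\<integral>\<^sup>+x. ennreal (G x) \<partial>M) = (\<Sum>k\<in>I. \<integral>\<^sup>+x. ennreal (u k x) \<partial>M)"
    using sum_integral_G[of "\<lambda>_. 1"] by simp
  also have "\<dots> \<le> (\<Sum>k\<in>I. ennreal (1 / c) * (\<integral>\<^sup>+x. ennreal (b k) * indicator (E k) x \<partial>M))"
  proof (rule sum_mono)
    fix k assume k: "k \<in> I"
    have "(\<integral>\<^sup>+x. ennreal (u k x) \<partial>M) \<le> ennreal (b k) * emeasure M (Q k)" by (rule u_integral_le[OF k])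
    also have "\<dots> = ennreal (1 / c) * (ennreal (b k) * (ennreal c * emeasure M (Q k)))"
      using c b_nonneg[OF k] by (simp add: mult.assoc[symmetric] ennreal_mult[symmetric])
    also have "\<dots> \<le> ennreal (1 / c) * (ennreal (b k) * emeasure M (E k))"
      by (intro mult_left_mono E_large[OF k]) auto
    finally show "(\<integral>\<^sup>+x. ennreal (u k x) \<partial>M) \<le> ennreal (1 / c) * (\<integral>\<^sup>+x. ennreal (b k) * indicator (E k) x \<partial>M)"
      using E_sets[OF k] by (simp add: nn_integral_cmult_indicator)
  qed
  also have "\<dots> = ennreal (1 / c) * (\<integral>\<^sup>+x. ennreal (F x) \<partial>M)"
    using sum_integral_F[of "\<lambda>_. 1"] by (simp add: sum_distrib_left)
  finally show ?thesis .
qed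

text \<open>For \<open>p > 1\<close> duality is used with \<open>G\<^bsup>p-1\<^esup>\<close> itself as test function. On the block \<open>u k\<close>, Hoelder's
  inequality replaces \<open>G\<^bsup>p-1\<^esup>\<close> by the \<open>L\<^bsup>q'\<^esup>\<close> average of \<open>G\<^bsup>p-1\<^esup>\<close> over \<open>Q k\<close>. This is below
  \<open>T\<^bsup>1/q'\<^esup>\<close> on all of \<open>Q k\<close>, hence on \<open>E k\<close>, where \<open>T\<close> is the maximal function of
  \<open>G\<^bsup>(p-1)q'\<^esup>\<close>. So \<open>\<integral> G\<^sup>p\<close> is controlled by \<open>\<integral> F T\<^bsup>1/q'\<^esup>\<close>. The condition \<open>p < q\<close> says
  exactly that the maximal theorem is applied with an exponent \<open>p'/q' > 1\<close>.\<close>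

lemma estimate_gt_1:
  assumes p: "1 < p" "p < q"
  shows "(\<integral>\<^sup>+x. ennreal (G x powr p) \<partial>M)
    \<le> ennreal ((1 / c * maximal_const D (p * (q - 1) / ((p - 1) * q)) powr (1 - 1 / p)) powr p)
      * (\<integral>\<^sup>+x. ennreal (F x powr p) \<partial>M)"
proof -
  \<comment> \<open>In terms of conjugate exponents, \<open>r = p'/q'\<close>, and \<open>e = (p-1) q'\<close> below.\<close>
  define r where "r = p * (q - 1) / ((p - 1) * q)"
  have r: "r > 1" using p q by (simp add: r_def field_simps)
  have r1: "r * (1 - 1 / p) = 1 - 1 / q" using p q by (simp add: r_def field_simps)
  define e where "e = (p - 1) / (1 - 1 / q)"
  have e: "e > 0" "e * (1 - 1 / q) = p - 1" using p q by (auto simp: e_def)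
  have "r = p * (1 - 1 / q) / (p - 1)" using p q by (simp add: r_def field_simps)
  then have er: "e * r = p" using p q by (simp add: e_def)
  define f where "f x = G x powr e" for x
  have [measurable]: "f \<in> borel_measurable M" unfolding f_def[abs_def] by measurable
  have f0: "f x \<ge> 0" for x by (simp add: f_def)
  have f1: "f x powr (1 - 1 / q) = G x powr (p - 1)" for x by (simp add: f_def powr_powr e)
  have f2: "f x powr r = G x powr p" for x by (simp add: f_def powr_powr er)
  obtain X where X: "X \<ge> 0" "(\<integral>\<^sup>+x. ennreal (G x powr p) \<partial>M) = ennreal X"
    using G_int_finite[of p] p by (cases "(\<integral>\<^sup>+x. ennreal (G x powr p) \<partial>M)") auto
  obtain Y where Y: "Y \<ge> 0" "(\<integral>\<^sup>+x. ennreal (F x powr p) \<partial>M) = ennreal Y"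
    using F_int_finite[of p] p by (cases "(\<integral>\<^sup>+x. ennreal (F x powr p) \<partial>M)") auto
  define m where "m k = enn2real (\<integral>\<^sup>+x. ennreal (f x) * indicator (Q k) x \<partial>M) / enn2real (emeasure M (Q k))" for k
  have m0: "m k \<ge> 0" for k by (simp add: m_def)
  have f_fin: "(\<integral>\<^sup>+x. ennreal (f x) * indicator (Q k) x \<partial>M) < \<infinity>" if "k \<in> I" for k
    using that Q_sets Q_fin e G_le G_nonneg unfolding f_def
    by (intro bounded_integral_finite[where B = "(real (card I) * \<bar>N\<bar>) powr e"] powr_mono2) auto
  have m: "ennreal (m k) * emeasure M (Q k) = (\<integral>\<^sup>+x. ennreal (f x) * indicator (Q k) x \<partial>M)" if "k \<in> I" for k
    unfolding m_def using that f_fin Q_pos Q_fin by (intro real_average_times) auto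
  define T where "T = max_fun I Q m"
  have [measurable]: "T \<in> borel_measurable M" unfolding T_def using fin Q_sets by (rule max_fun_measurable)
  have T0: "T x \<ge> 0" for x using fin by (simp add: T_def max_fun_nonneg)
  define S where "S = maximal_const D r"
  have S: "S > 0" unfolding S_def using D_pos r by (rule maximal_const_pos)
  have T_int: "(\<integral>\<^sup>+x. ennreal (T x powr r) \<partial>M) \<le> ennreal (S * X)"
    unfolding T_def S_def using vitali r f0 m X by (intro strong_type_max_fun[where f = f]) (auto simp: f2)
  have "ennreal X = (\<integral>\<^sup>+x. ennreal (G x * f x powr (1 - 1 / q)) \<partial>M)"
  proof -
    have "G x powr p = G x * f x powr (1 - 1 / q)" for x
      unfolding f1 using G_nonneg[of x] by (cases "G x = 0") (auto simp: powr_diff)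
    then show ?thesis by (simp add: X(2)[symmetric])
  qed
  also have "\<dots> = (\<Sum>k\<in>I. \<integral>\<^sup>+x. ennreal (u k x * f x powr (1 - 1 / q)) \<partial>M)"
    by (rule sum_integral_G) auto
  also have "\<dots> \<le> (\<Sum>k\<in>I. ennreal (1 / c) * (\<integral>\<^sup>+x. ennreal (b k * T x powr (1 - 1 / q)) * indicator (E k) x \<partial>M))"
  proof (rule sum_mono)
    fix k assume k: "k \<in> I"
    have [measurable]: "E k \<in> sets M" by (rule E_sets[OF k])
    have "(\<integral>\<^sup>+x. ennreal (u k x * f x powr (1 - 1 / q)) \<partial>M) \<le> ennreal (b k * m k powr (1 - 1 / q)) * emeasure M (Q k)"
      using k u_meas Q_sets u_nonneg f0 q b_nonneg m0 Q_fin u_supp u_size m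
      by (intro Holder_averages) auto
    also have "\<dots> = ennreal (1 / c) * (ennreal (b k * m k powr (1 - 1 / q)) * (ennreal c * emeasure M (Q k)))"
      using c b_nonneg[OF k] by (simp add: mult.assoc[symmetric] ennreal_mult[symmetric])
    also have "\<dots> \<le> ennreal (1 / c) * (ennreal (b k * m k powr (1 - 1 / q)) * emeasure M (E k))"
      by (intro mult_left_mono E_large[OF k]) auto
    also have "\<dots> = ennreal (1 / c) * (\<integral>\<^sup>+x. ennreal (b k * m k powr (1 - 1 / q)) * indicator (E k) x \<partial>M)"
      by (simp add: nn_integral_cmult_indicator)
    also have "\<dots> \<le> ennreal (1 / c) * (\<integral>\<^sup>+x. ennreal (b k * T x powr (1 - 1 / q)) * indicator (E k) x \<partial>M)"
    proof (intro mult_left_mono nn_integral_mono)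
      fix x show "ennreal (b k * m k powr (1 - 1 / q)) * indicator (E k) x \<le> ennreal (b k * T x powr (1 - 1 / q)) * indicator (E k) x"
      proof (cases "x \<in> E k")
        case True
        then have "m k \<le> T x" unfolding T_def using k fin E_sub[OF k] by (intro max_fun_ge) auto
        then show ?thesis using m0[of k] q b_nonneg[OF k]
          by (intro mult_right_mono ennreal_leI mult_left_mono powr_mono2) auto
      qed simp
    qed auto
    finally show "(\<integral>\<^sup>+x. ennreal (u k x * f x powr (1 - 1 / q)) \<partial>M) \<le> \<dots>" .
  qed
  also have "\<dots> = ennreal (1 / c) * (\<integral>\<^sup>+x. ennreal (F x * T x powr (1 - 1 / q)) \<partial>M)"
    by (subst sum_integral_F) (auto simp: sum_distrib_left)
  also have "(\<lambda>x. F x * T x powr (1 - 1 / q)) = (\<lambda>x. (F x powr p) powr (1 / p) * (T x powr r) powr (1 - 1 / p))"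
    using p F_nonneg by (simp add: powr_powr r1)
  also have "(\<integral>\<^sup>+x. ennreal ((F x powr p) powr (1 / p) * (T x powr r) powr (1 - 1 / p)) \<partial>M)
    \<le> ennreal (Y powr (1 / p) * (S * X) powr (1 - 1 / p))"
    using p X Y S T_int by (intro nn_integral_powr_Holder) auto
  finally have "ennreal X \<le> ennreal (1 / c) * ennreal (Y powr (1 / p) * (S * X) powr (1 - 1 / p))"
    by (simp add: mult_left_mono)
  also have "\<dots> = ennreal ((1 / c * S powr (1 - 1 / p)) * (Y powr (1 / p) * X powr (1 - 1 / p)))"
    using S X c by (simp add: ennreal_mult[symmetric] powr_mult mult_ac)
  finally have "X \<le> (1 / c * S powr (1 - 1 / p)) * (Y powr (1 / p) * X powr (1 - 1 / p))"
    using c by (simp add: ennreal_le_iff)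
  then have "X \<le> (1 / c * S powr (1 - 1 / p)) powr (1 / (1 / p)) * Y"
    using X Y S c p by (intro powr_absorb) auto
  then have "ennreal X \<le> ennreal ((1 / c * S powr (1 - 1 / p)) powr p * Y)"
    by (simp add: ennreal_leI)
  then show ?thesis unfolding X(2) Y(2) using Y(1) by (simp add: ennreal_mult S_def r_def)
qed

text \<open>For \<open>p < 1\<close> the duality is replaced by a reverse one: with \<open>T\<close> the maximal function of
  \<open>F\<^bsup>p/2\<^esup>\<close> and \<open>\<beta> = 2 (1 - p) / p\<close>,
  \<open>G\<^sup>p = (G T\<^bsup>-\<beta>\<^esup>)\<^sup>p (T\<^sup>2)\<^bsup>1-p\<^esup>\<close>, and \<open>\<integral> T\<^sup>2\<close> is at most a constant times \<open>\<integral> F\<^sup>p\<close> by the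
  maximal theorem. The factor \<open>G T\<^bsup>-\<beta>\<^esup>\<close> is linear in \<open>G\<close>, so it can be integrated block by block. On
  \<open>Q k\<close> one has \<open>T\<^bsup>-\<beta>\<^esup> \<le> m\<^bsup>-\<beta>\<^esup>\<close> with \<open>m\<close> the average of \<open>F\<^bsup>p/2\<^esup>\<close>, and by Hoelder's inequality
  (the convexity of negative powers) \<open>m\<^bsup>-\<beta>\<^esup>\<close> is at most a constant times the average of
  \<open>F\<^bsup>p-1\<^esup>\<close> over \<open>E k\<close>. Summation gives \<open>\<integral> F F\<^bsup>p-1\<^esup>\<close>. Positivity of the \<open>b k\<close> keeps \<open>F\<close> positive on
  every \<open>E k\<close>, so that its negative powers make sense there.\<close>

lemma estimate_lt_1_nonzero:
  assumes p: "0 < p" "p < 1" and b_pos: "\<And>k. k \<in> I \<Longrightarrow> b k > 0"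
  shows "(\<integral>\<^sup>+x. ennreal (G x powr p) \<partial>M)
    \<le> ennreal ((1 / c) powr (2 - p) * maximal_const D 2 powr (1 - p)) * (\<integral>\<^sup>+x. ennreal (F x powr p) \<partial>M)"
proof -
  define \<beta> where "\<beta> = 2 * (1 - p) / p"
  \<comment> \<open>The exponent for which \<open>(F\<^bsup>p-1\<^esup>)\<^sup>a (F\<^bsup>p/2\<^esup>)\<^bsup>1-a\<^esup> = 1\<close>, so that Hoelder's inequality
    bounds the measure of \<open>E k\<close>.\<close>
  define a where "a = p / (2 - p)"
  have \<beta>: "\<beta> > 0" using p by (simp add: \<beta>_def)
  have a: "0 < a" "a < 1" using p by (auto simp: a_def)
  have a1: "(1 - a) / a = \<beta>" using p by (simp add: a_def \<beta>_def field_simps)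
  have a2: "(p - 1) * a + p * (1 - a) / 2 = 0" using p by (simp add: a_def field_simps)
  define f where "f x = F x powr (p / 2)" for x
  have [measurable]: "f \<in> borel_measurable M" unfolding f_def[abs_def] by measurable
  have f0: "f x \<ge> 0" for x by (simp add: f_def)
  obtain Y where Y: "Y \<ge> 0" "(\<integral>\<^sup>+x. ennreal (F x powr p) \<partial>M) = ennreal Y"
    using F_int_finite[of p] p by (cases "(\<integral>\<^sup>+x. ennreal (F x powr p) \<partial>M)") auto
  define m where "m k = enn2real (\<integral>\<^sup>+x. ennreal (f x) * indicator (Q k) x \<partial>M) / enn2real (emeasure M (Q k))" for k
  have m0: "m k \<ge> 0" for k by (simp add: m_def)
  have f_fin: "(\<integral>\<^sup>+x. ennreal (f x) * indicator (Q k) x \<partial>M) < \<infinity>" if "k \<in> I" for k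
    using that Q_sets Q_fin p F_le F_nonneg unfolding f_def
    by (intro bounded_integral_finite[where B = "(\<Sum>k\<in>I. b k) powr (p / 2)"] powr_mono2) auto
  have m: "ennreal (m k) * emeasure M (Q k) = (\<integral>\<^sup>+x. ennreal (f x) * indicator (Q k) x \<partial>M)" if "k \<in> I" for k
    unfolding m_def using that f_fin Q_pos Q_fin by (intro real_average_times) auto
  define T where "T = max_fun I Q m"
  have [measurable]: "T \<in> borel_measurable M" unfolding T_def using fin Q_sets by (rule max_fun_measurable)
  have T0: "T x \<ge> 0" for x using fin by (simp add: T_def max_fun_nonneg)
  have T_ge: "k \<in> I \<Longrightarrow> x \<in> Q k \<Longrightarrow> m k \<le> T x" for k x
    unfolding T_def using fin by (rule max_fun_ge)
  define S where "S = maximal_const D 2"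
  have S: "S > 0" unfolding S_def using D_pos by (rule maximal_const_pos) simp
  have ff: "f x powr 2 = F x powr p" for x by (simp add: f_def powr_powr)
  have T_int: "(\<integral>\<^sup>+x. ennreal (T x powr 2) \<partial>M) \<le> ennreal (S * Y)"
    unfolding T_def S_def
  proof (rule strong_type_max_fun[where f = f])
    show "vitali_family M D I Q" by (rule vitali)
    show "(\<integral>\<^sup>+x. ennreal (f x powr 2) \<partial>M) \<le> ennreal Y"
      unfolding ff Y(2) by simp
  qed (use f0 m Y in auto)

  have block: "m k > 0 \<and> ennreal (m k powr (- \<beta>)) * emeasure M (Q k)
      \<le> ennreal ((1 / c) powr (1 / a)) * (\<integral>\<^sup>+x. ennreal (F x powr (p - 1)) * indicator (E k) x \<partial>M)"
    if k: "k \<in> I" for k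
  proof -
    have [measurable]: "E k \<in> sets M" "Q k \<in> sets M" using E_sets Q_sets k by auto
    obtain s where s: "s > 0" "emeasure M (Q k) = ennreal s"
      using Q_fin[OF k] Q_pos[OF k] by (cases "emeasure M (Q k)") auto
    have EQ: "emeasure M (E k) \<le> emeasure M (Q k)"
      using E_sub[OF k] by (intro emeasure_mono) auto
    then obtain s' where s': "s' \<ge> 0" "emeasure M (E k) = ennreal s'"
      using s by (cases "emeasure M (E k)") (auto simp: top_unique)
    have css: "c * s \<le> s'" using E_large[OF k] s s' c by (simp add: ennreal_mult[symmetric])
    have Epos: "emeasure M (E k) > 0"
      using less_le_trans[OF mult_pos_pos[OF c s(1)] css] by (simp add: s'(2))
    have "0 < ennreal (b k powr (p / 2)) * emeasure M (E k)"
      using b_pos[OF k] Epos by (simp add: ennreal_zero_less_mult_iff)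
    also have "\<dots> = (\<integral>\<^sup>+x. ennreal (b k powr (p / 2)) * indicator (E k) x \<partial>M)"
      by (simp add: nn_integral_cmult_indicator)
    also have "\<dots> \<le> (\<integral>\<^sup>+x. ennreal (f x) * indicator (Q k) x \<partial>M)"
    proof (rule nn_integral_mono)
      fix x show "ennreal (b k powr (p / 2)) * indicator (E k) x \<le> ennreal (f x) * indicator (Q k) x"
      proof (cases "x \<in> E k")
        case True
        then have "b k powr (p / 2) \<le> f x" unfolding f_def
          using b_le_F[OF k True] b_pos[OF k] p by (intro powr_mono2) auto
        then show ?thesis using True E_sub[OF k] by (auto simp: indicator_def intro: ennreal_leI)
      qed simp
    qed
    also have "\<dots> = ennreal (m k) * emeasure M (Q k)" by (simp add: m[OF k])
    finally have mpos: "m k > 0" by (simp add: ennreal_zero_less_mult_iff)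
    have "(\<integral>\<^sup>+x. ennreal (F x powr (p - 1)) * indicator (E k) x \<partial>M) \<le> (\<integral>\<^sup>+x. ennreal (b k powr (p - 1)) * indicator (E k) x \<partial>M)"
    proof (rule nn_integral_mono)
      fix x show "ennreal (F x powr (p - 1)) * indicator (E k) x \<le> ennreal (b k powr (p - 1)) * indicator (E k) x"
        using b_le_F[OF k, of x] b_pos[OF k] p
        by (cases "x \<in> E k") (auto intro!: ennreal_leI powr_mono2')
    qed
    also have "\<dots> = ennreal (b k powr (p - 1)) * emeasure M (E k)"
      by (simp add: nn_integral_cmult_indicator)
    also have "\<dots> < \<infinity>" using s' by (simp add: ennreal_mult_less_top)
    finally obtain Z where Z: "Z \<ge> 0" "(\<integral>\<^sup>+x. ennreal (F x powr (p - 1)) * indicator (E k) x \<partial>M) = ennreal Z"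
      by (cases "(\<integral>\<^sup>+x. ennreal (F x powr (p - 1)) * indicator (E k) x \<partial>M)") auto
    have "ennreal s' = (\<integral>\<^sup>+x. ennreal ((F x powr (p - 1) * indicator (E k) x) powr a * (f x * indicator (Q k) x) powr (1 - a)) \<partial>M)"
    proof -
      have "ennreal ((F x powr (p - 1) * indicator (E k) x) powr a * (f x * indicator (Q k) x) powr (1 - a)) = indicator (E k) x" for x
      proof (cases "x \<in> E k")
        case True
        then have "F x > 0" using b_le_F[OF k True] b_pos[OF k] by linarith
        then have "(F x powr (p - 1)) powr a * f x powr (1 - a) = 1"
          unfolding f_def powr_powr by (simp add: powr_add[symmetric] a2)
        then show ?thesis using True E_sub[OF k] by (auto simp: indicator_def)
      qed (use a in simp)
      then show ?thesis by (simp add: s')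
    qed
    also have "\<dots> \<le> ennreal (Z powr a * (m k * s) powr (1 - a))"
    proof (rule nn_integral_powr_Holder)
      show "(\<integral>\<^sup>+x. ennreal (F x powr (p - 1) * indicator (E k) x) \<partial>M) \<le> ennreal Z"
        using Z by (simp add: ennreal_mult ennreal_indicator)
      show "(\<integral>\<^sup>+x. ennreal (f x * indicator (Q k) x) \<partial>M) \<le> ennreal (m k * s)"
        using m[OF k] s mpos f0 by (simp add: ennreal_mult ennreal_indicator)
    qed (use a f0 Z mpos s in auto)
    finally have "s' \<le> Z powr a * (m k * s) powr (1 - a)" using mpos s by simp
    then have "c * s \<le> Z powr a * (m k powr (1 - a) * s powr (1 - a))"
      using css s mpos by (simp add: powr_mult)
    moreover have "s = s powr a * s powr (1 - a)" using s by (simp add: powr_add[symmetric])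
    ultimately have "(c * s powr a) * s powr (1 - a) \<le> (Z powr a * m k powr (1 - a)) * s powr (1 - a)"
      by (simp add: mult_ac)
    then have "c * s powr a \<le> Z powr a * m k powr (1 - a)" using s by simp
    then have "s powr a * (1 / m k powr (1 - a)) \<le> 1 / c * Z powr a"
      using c mpos by (simp add: divide_simps mult_ac)
    then have "s powr a * m k powr (- (1 - a)) \<le> 1 / c * Z powr a"
      by (simp only: powr_minus inverse_eq_divide)
    then have "(s powr a * m k powr (- (1 - a))) powr (1 / a) \<le> (1 / c * Z powr a) powr (1 / a)"
      using a by (intro powr_mono2) auto
    moreover have "(s powr a * m k powr (- (1 - a))) powr (1 / a) = m k powr (- \<beta>) * s"
    proof -
      have "- (1 - a) * (1 / a) = - \<beta>" unfolding a1[symmetric] using a by (simp add: field_simps)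
      then show ?thesis using a s mpos by (simp only: powr_mult powr_powr) simp
    qed
    moreover have "(1 / c * Z powr a) powr (1 / a) = (1 / c) powr (1 / a) * Z"
      using a c Z by (subst powr_mult) (auto simp: powr_powr)
    ultimately have "m k powr (- \<beta>) * s \<le> (1 / c) powr (1 / a) * Z" by simp
    then show ?thesis using mpos s Z by (simp add: ennreal_mult[symmetric])
  qed

  define C where "C = (1 / c) powr (1 / a)"
  have C: "C > 0" using c by (simp add: C_def)
  have weighted: "(\<integral>\<^sup>+x. ennreal (G x * T x powr (- \<beta>)) \<partial>M) \<le> ennreal (C * Y)"
  proof -
    have "(\<integral>\<^sup>+x. ennreal (G x * T x powr (- \<beta>)) \<partial>M) = (\<Sum>k\<in>I. \<integral>\<^sup>+x. ennreal (u k x * T x powr (- \<beta>)) \<partial>M)"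
      by (rule sum_integral_G) auto
    also have "\<dots> \<le> (\<Sum>k\<in>I. ennreal C * (\<integral>\<^sup>+x. ennreal (b k * F x powr (p - 1)) * indicator (E k) x \<partial>M))"
    proof (rule sum_mono)
      fix k assume k: "k \<in> I"
      have [measurable]: "E k \<in> sets M" "u k \<in> borel_measurable M" using E_sets u_meas k by auto
      have "(\<integral>\<^sup>+x. ennreal (u k x * T x powr (- \<beta>)) \<partial>M) \<le> (\<integral>\<^sup>+x. ennreal (m k powr (- \<beta>)) * ennreal (u k x) \<partial>M)"
      proof (rule nn_integral_mono)
        fix x
        show "ennreal (u k x * T x powr (- \<beta>)) \<le> ennreal (m k powr (- \<beta>)) * ennreal (u k x)"
        proof (cases "x \<in> Q k")
          case True
          then have "T x powr (- \<beta>) \<le> m k powr (- \<beta>)"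
            using T_ge[OF k True] block[OF k] \<beta> by (intro powr_mono2') auto
          then show ?thesis using u_nonneg[OF k, of x]
            by (simp add: ennreal_mult[symmetric] mult.commute mult_left_mono ennreal_leI)
        qed (use u_supp[OF k] in simp)
      qed
      also have "\<dots> = ennreal (m k powr (- \<beta>)) * (\<integral>\<^sup>+x. ennreal (u k x) \<partial>M)"
        by (simp add: nn_integral_cmult)
      also have "\<dots> \<le> ennreal (m k powr (- \<beta>)) * (ennreal (b k) * emeasure M (Q k))"
        by (intro mult_left_mono u_integral_le k) auto
      also have "\<dots> = ennreal (b k) * (ennreal (m k powr (- \<beta>)) * emeasure M (Q k))"
        by (simp add: mult_ac)
      also have "\<dots> \<le> ennreal (b k) * (ennreal C * (\<integral>\<^sup>+x. ennreal (F x powr (p - 1)) * indicator (E k) x \<partial>M))"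
        unfolding C_def using block[OF k] by (intro mult_left_mono) auto
      also have "\<dots> = ennreal C * (\<integral>\<^sup>+x. ennreal (b k) * (ennreal (F x powr (p - 1)) * indicator (E k) x) \<partial>M)"
        by (subst nn_integral_cmult) (auto simp: mult_ac)
      also have "\<dots> = ennreal C * (\<integral>\<^sup>+x. ennreal (b k * F x powr (p - 1)) * indicator (E k) x \<partial>M)"
        using b_nonneg[OF k] by (simp add: ennreal_mult mult.assoc)
      finally show "(\<integral>\<^sup>+x. ennreal (u k x * T x powr (- \<beta>)) \<partial>M) \<le> \<dots>" .
    qed
    also have "\<dots> = ennreal C * (\<integral>\<^sup>+x. ennreal (F x * F x powr (p - 1)) \<partial>M)"
      by (subst sum_integral_F) (auto simp: sum_distrib_left)
    also have "(\<lambda>x. F x * F x powr (p - 1)) = (\<lambda>x. F x powr p)"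
    proof
      fix x show "F x * F x powr (p - 1) = F x powr p"
        using F_nonneg[of x] by (cases "F x = 0") (auto simp: powr_diff)
    qed
    finally show ?thesis using Y C by (simp add: ennreal_mult)
  qed

  have "(\<integral>\<^sup>+x. ennreal (G x powr p) \<partial>M)
      = (\<integral>\<^sup>+x. ennreal ((G x * T x powr (- \<beta>)) powr p * (T x powr 2) powr (1 - p)) \<partial>M)"
  proof (rule nn_integral_cong)
    fix x
    show "ennreal (G x powr p) = ennreal ((G x * T x powr (- \<beta>)) powr p * (T x powr 2) powr (1 - p))"
    proof (cases "G x = 0")
      case False
      then obtain k where k: "k \<in> I" "x \<in> Q k" using G_supp by auto
      then have "T x > 0" using T_ge[OF k] block[OF k(1)] by linarith
      moreover have "\<beta> * p = 2 * (1 - p)" using p by (simp add: \<beta>_def)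
      ultimately have "(T x powr (- \<beta>)) powr p * (T x powr 2) powr (1 - p) = 1"
        unfolding powr_powr by (simp add: powr_add[symmetric])
      then show ?thesis using G_nonneg[of x] by (simp add: powr_mult mult.assoc)
    qed (use p in simp)
  qed
  also have "\<dots> \<le> ennreal ((C * Y) powr p * (S * Y) powr (1 - p))"
    using weighted T_int p C S Y G_nonneg by (intro nn_integral_powr_Holder) auto
  also have "(C * Y) powr p * (S * Y) powr (1 - p) = C powr p * S powr (1 - p) * Y"
  proof (cases "Y = 0")
    case False
    then have "Y powr p * Y powr (1 - p) = Y" using Y by (simp add: powr_add[symmetric])
    then show ?thesis using Y C S by (simp add: powr_mult)
  qed simp
  also have "C powr p = (1 / c) powr (2 - p)" using p by (simp add: C_def powr_powr a_def)
  finally show ?thesis using Y by (simp add: S_def ennreal_mult)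
qed

lemma nonzero_blocks: "block_family M D c q {k\<in>I. 0 < b k} Q E u b N"
  by unfold_locales
    (use vitali_family_subset[OF vitali, of "{k\<in>I. 0 < b k}"] c q E_sets E_sub E_large u_meas u_nonneg
      u_le u_supp b_nonneg u_size in auto)

text \<open>Blocks with \<open>b k = 0\<close> vanish almost everywhere and may be dropped.\<close>

lemma estimate_lt_1:
  assumes p: "0 < p" "p < 1"
  shows "(\<integral>\<^sup>+x. ennreal (G x powr p) \<partial>M)
    \<le> ennreal ((1 / c) powr (2 - p) * maximal_const D 2 powr (1 - p)) * (\<integral>\<^sup>+x. ennreal (F x powr p) \<partial>M)"
proof -
  interpret nz: block_family M D c q "{k\<in>I. 0 < b k}" Q E u b N by (rule nonzero_blocks)
  have "AE x in M. u k x = 0" if k: "k \<in> I" "\<not> 0 < b k" for k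
  proof -
    have [measurable]: "u k \<in> borel_measurable M" using k u_meas by auto
    have "(\<integral>\<^sup>+x. ennreal (u k x powr q) \<partial>M) = 0"
      using u_size[of k] b_nonneg[of k] k by (simp add: antisym_conv)
    then show ?thesis using u_nonneg k by (simp add: nn_integral_0_iff_AE)
  qed
  then have "AE x in M. \<forall>k\<in>{k\<in>I. \<not> 0 < b k}. u k x = 0"
    using fin by (intro AE_finite_allI) auto
  then have "AE x in M. G x = nz.G x"
    by eventually_elim (auto simp: G_def nz.G_def fin intro!: sum.mono_neutral_right)
  then have "(\<integral>\<^sup>+x. ennreal (G x powr p) \<partial>M) = (\<integral>\<^sup>+x. ennreal (nz.G x powr p) \<partial>M)"
    by (intro nn_integral_cong_AE) auto
  moreover have "F x = nz.F x" for x
    unfolding F_def nz.F_def using fin b_nonneg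
    by (intro sum.mono_neutral_right) (auto simp: order.order_iff_strict)
  ultimately show ?thesis using nz.estimate_lt_1_nonzero[OF p] by simp
qed

end

definition block_const :: "real \<Rightarrow> real \<Rightarrow> real \<Rightarrow> real \<Rightarrow> real"
  where "block_const D c p q =
    (if p = 1 then 1 / c
     else if p < 1 then (1 / c) powr (2 - p) * maximal_const D 2 powr (1 - p)
     else (1 / c * maximal_const D (p * (q - 1) / ((p - 1) * q)) powr (1 - 1 / p)) powr p)"

lemma block_const_pos: "0 < c \<Longrightarrow> 0 < D \<Longrightarrow> 0 < p \<Longrightarrow> p < q \<Longrightarrow> 1 < q \<Longrightarrow> block_const D c p q > 0"
proof (cases p "1::real" rule: linorder_cases)
  case greater
  assume *: "0 < c" "0 < D" "p < q" "1 < q"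
  have "p * (q - 1) / ((p - 1) * q) > 1" using greater * by (simp add: field_simps)
  then have "maximal_const D (p * (q - 1) / ((p - 1) * q)) > 0" using * by (intro maximal_const_pos)
  then show ?thesis using greater * by (simp add: block_const_def)
next
  case less
  assume *: "0 < c" "0 < D"
  then show ?thesis using maximal_const_pos[of D 2] less by (simp add: block_const_def)
qed (simp add: block_const_def)

lemma (in block_family) estimate:
  assumes "0 < p" "p < q"
  shows "(\<integral>\<^sup>+x. ennreal (G x powr p) \<partial>M) \<le> ennreal (block_const D c p q) * (\<integral>\<^sup>+x. ennreal (F x powr p) \<partial>M)"
  using estimate_lt_1[of p] estimate_gt_1[of p] estimate_eq_1 assms G_nonneg F_nonneg
  by (cases p "1::real" rule: linorder_cases) (auto simp: block_const_def)

section \<open>Cubes and reverse Hoelder weights\<close>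

text \<open>Cubes by centre and half side length, so that dilation about the centre is scaling of \<open>r\<close>.\<close>

definition qcube :: "real ^ 'n \<Rightarrow> real \<Rightarrow> (real ^ 'n) set"
  where "qcube a r = cbox (\<chi> i. a $ i - r) (\<chi> i. a $ i + r)"

lemma mem_qcube: "x \<in> qcube a r \<longleftrightarrow> (\<forall>i. a $ i - r \<le> x $ i \<and> x $ i \<le> a $ i + r)"
  by (simp add: qcube_def mem_box_cart)

lemma qcube_mono: "r \<le> r' \<Longrightarrow> qcube a r \<subseteq> qcube a r'"
  unfolding subset_iff mem_qcube by (meson add_left_mono diff_left_mono order_trans)

lemma cubes_eq_qcube: "cubes = {qcube a r |a r. 0 < r}"
proof -
  have "\<exists>a' r. cbox a (\<chi> i. a $ i + l) = qcube a' r \<and> 0 < r" if "l > 0" for a :: "real ^ 'n" and l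
    using that by (intro exI[of _ "\<chi> i. a $ i + l / 2"] exI[of _ "l / 2"]) (auto simp: set_eq_iff mem_qcube mem_box_cart algebra_simps)
  moreover have "\<exists>a' l. qcube a r = cbox a' (\<chi> i. a' $ i + l) \<and> 0 < l" if "r > 0" for a :: "real ^ 'n" and r
    using that by (intro exI[of _ "\<chi> i. a $ i - r"] exI[of _ "2 * r"]) (auto simp: set_eq_iff mem_qcube mem_box_cart algebra_simps)
  ultimately show ?thesis by (fastforce simp: cubes_def)
qed

lemma qcube_in_cubes: "r > 0 \<Longrightarrow> qcube a r \<in> cubes"
  by (auto simp: cubes_eq_qcube)

lemma qcube_sets [measurable, simp]: "qcube a r \<in> sets lebesgue"
  by (simp add: qcube_def)

lemma emeasure_qcube:
  fixes a :: "real ^ 'n"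
  assumes "r > 0"
  shows "emeasure lebesgue (qcube a r) = ennreal ((2 * r) ^ CARD('n))"
proof -
  have ne: "qcube a r \<noteq> {}" using assms by (auto simp: mem_qcube set_eq_iff intro!: exI[of _ a])
  have "measure lborel (qcube a r) = (2 * r) ^ CARD('n)"
    using ne unfolding qcube_def by (subst content_cbox_cart) auto
  moreover have "emeasure lborel (qcube a r) = ennreal (measure lborel (qcube a r))"
    unfolding qcube_def by (intro emeasure_eq_ennreal_measure) (simp add: emeasure_lborel_cbox_eq)
  ultimately show ?thesis by (simp add: qcube_def)
qed

declare emeasure_completion [simp del]

text \<open>Greedy selection: take a cube of largest side, discard all cubes that meet it (they lie in its
  threefold dilate), and continue with the rest.\<close>

lemma qcube_Vitali_covering:
  assumes "finite J"
  shows "\<exists>J'\<subseteq>J. disjoint_family_on (\<lambda>k. qcube (a k) (r k)) J' \<and>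
    (\<Union>k\<in>J. qcube (a k) (r k)) \<subseteq> (\<Union>k\<in>J'. qcube (a k) (3 * r k))"
  using assms
proof (induction J rule: finite_psubset_induct)
  case (psubset J)
  show ?case
  proof (cases "J = {}")
    case False
    obtain k0 where k0: "k0 \<in> J" "\<And>k. k \<in> J \<Longrightarrow> r k \<le> r k0"
    proof -
      have "Max (r ` J) \<in> r ` J" using psubset False by (intro Max_in) auto
      then obtain k where "k \<in> J" "r k = Max (r ` J)" by auto
      then show ?thesis using that[of k] psubset by auto
    qed
    define Q where "Q k = qcube (a k) (r k)" for k
    define J1 where "J1 = {k\<in>J. k \<noteq> k0 \<and> Q k \<inter> Q k0 = {}}"
    have "J1 \<subset> J" using k0 by (auto simp: J1_def)
    then obtain J1' where J1': "J1' \<subseteq> J1" "disjoint_family_on Q J1'"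
      "(\<Union>k\<in>J1. Q k) \<subseteq> (\<Union>k\<in>J1'. qcube (a k) (3 * r k))"
      using psubset.IH[of J1] by (auto simp: Q_def[abs_def])
    have near: "Q k \<subseteq> qcube (a k0) (3 * r k0)" if k: "k \<in> J" "Q k \<inter> Q k0 \<noteq> {}" for k
    proof
      fix x assume x: "x \<in> Q k"
      obtain y where y: "y \<in> Q k" "y \<in> Q k0" using k by auto
      show "x \<in> qcube (a k0) (3 * r k0)"
        unfolding mem_qcube
      proof
        fix i
        have "a k $ i - r k \<le> x $ i" "x $ i \<le> a k $ i + r k" "a k $ i - r k \<le> y $ i" "y $ i \<le> a k $ i + r k"
          "a k0 $ i - r k0 \<le> y $ i" "y $ i \<le> a k0 $ i + r k0"
          using x y by (auto simp: Q_def mem_qcube)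
        then show "a k0 $ i - 3 * r k0 \<le> x $ i \<and> x $ i \<le> a k0 $ i + 3 * r k0"
          using k0(2)[OF k(1)] by linarith
      qed
    qed
    have self: "Q k0 \<subseteq> qcube (a k0) (3 * r k0)"
    proof (cases "Q k0 = {}")
      case False
      then show ?thesis using near[of k0] k0 by auto
    qed simp
    have "disjoint_family_on Q (insert k0 J1')"
      using J1' by (auto simp: disjoint_family_on_def J1_def)
    moreover have "insert k0 J1' \<subseteq> J" using J1' k0 by (auto simp: J1_def)
    moreover have "(\<Union>k\<in>J. Q k) \<subseteq> (\<Union>k\<in>insert k0 J1'. qcube (a k) (3 * r k))"
    proof
      fix x assume "x \<in> (\<Union>k\<in>J. Q k)"
      then obtain k where k: "k \<in> J" "x \<in> Q k" by auto
      then show "x \<in> (\<Union>k\<in>insert k0 J1'. qcube (a k) (3 * r k))"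
        using near[of k] self J1'(3) by (cases "k \<in> J1") (auto simp: J1_def)
    qed
    ultimately show ?thesis unfolding Q_def by blast
  qed (auto simp: disjoint_family_on_def)
qed

text \<open>A real positive version of a weight in the reverse Hoelder class. The number \<open>W Q\<close> stands
  for the \<open>L\<^sup>s\<close> average of \<open>w\<close> over \<open>Q\<close>; the reverse Hoelder inequality says that it is at most \<open>C\<close> times
  the plain average.\<close>

locale reverse_Holder_weight =
  fixes w :: "real ^ 'n \<Rightarrow> real" and s C :: real and W :: "(real ^ 'n) set \<Rightarrow> real"
  assumes w_meas [measurable]: "w \<in> borel_measurable lebesgue" and w_pos: "0 < w x"
    and s: "1 < s" and C: "0 < C"
    and W_pos: "Q \<in> cubes \<Longrightarrow> 0 < W Q"
    and W_eq: "Q \<in> cubes \<Longrightarrow>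
      (\<integral>\<^sup>+x. ennreal (w x powr s) * indicator Q x \<partial>lebesgue) = ennreal (W Q powr s) * emeasure lebesgue Q"
    and W_le: "Q \<in> cubes \<Longrightarrow>
      ennreal (W Q) * emeasure lebesgue Q \<le> ennreal C * (\<integral>\<^sup>+x. ennreal (w x) * indicator Q x \<partial>lebesgue)"
begin

definition \<sigma> :: "(real ^ 'n) measure"
  where "\<sigma> = density lebesgue (\<lambda>x. ennreal (w x powr s))"

lemma sets_\<sigma> [simp, measurable_cong]: "sets \<sigma> = sets lebesgue"
  by (simp add: \<sigma>_def)

lemma emeasure_\<sigma>: "A \<in> sets lebesgue \<Longrightarrow> emeasure \<sigma> A = (\<integral>\<^sup>+x. ennreal (w x powr s) * indicator A x \<partial>lebesgue)"
  by (simp add: \<sigma>_def emeasure_density)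

definition mass :: "(real ^ 'n) set \<Rightarrow> ennreal"
  where "mass A = (\<integral>\<^sup>+x. ennreal (w x) * indicator A x \<partial>lebesgue)"

lemma mass_mono: "A \<subseteq> B \<Longrightarrow> mass A \<le> mass B"
  unfolding mass_def by (intro nn_integral_mono mult_left_mono) (auto simp: indicator_def)

lemma mass_Un_le:
  assumes [measurable]: "A \<in> sets lebesgue" "B \<in> sets lebesgue"
  shows "mass (A \<union> B) \<le> mass A + mass B"
proof -
  have "mass (A \<union> B) \<le> (\<integral>\<^sup>+x. ennreal (w x) * indicator A x + ennreal (w x) * indicator B x \<partial>lebesgue)"
    unfolding mass_def by (intro nn_integral_mono) (auto simp: indicator_def)
  also have "\<dots> = mass A + mass B" unfolding mass_def by (rule nn_integral_add) auto
  finally show ?thesis .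
qed

lemma mass_le:
  assumes [measurable]: "A \<in> sets lebesgue"
    and x: "x \<ge> 0" "emeasure \<sigma> A \<le> ennreal x" and y: "y \<ge> 0" "emeasure lebesgue A \<le> ennreal y"
  shows "mass A \<le> ennreal (x powr (1 / s) * y powr (1 - 1 / s))"
proof -
  have "mass A = (\<integral>\<^sup>+z. ennreal ((w z powr s * indicator A z) powr (1 / s) * (indicator A z) powr (1 - 1 / s)) \<partial>lebesgue)"
    unfolding mass_def
  proof (rule nn_integral_cong)
    fix z show "ennreal (w z) * indicator A z
      = ennreal ((w z powr s * indicator A z) powr (1 / s) * (indicator A z) powr (1 - 1 / s))"
      using w_pos[of z] s by (cases "z \<in> A") (auto simp: powr_powr)
  qed
  also have "\<dots> \<le> ennreal (x powr (1 / s) * y powr (1 - 1 / s))"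
  proof (rule nn_integral_powr_Holder)
    show "(\<integral>\<^sup>+z. ennreal (w z powr s * indicator A z) \<partial>lebesgue) \<le> ennreal x"
      using x by (simp add: emeasure_\<sigma> ennreal_mult ennreal_indicator)
    show "(\<integral>\<^sup>+z. ennreal (indicator A z) \<partial>lebesgue) \<le> ennreal y"
      using y by (simp add: ennreal_indicator)
  qed (use x y s in auto)
  finally show ?thesis .
qed

lemma cube_facts:
  assumes "Q \<in> cubes"
  obtains V where "V > 0" "emeasure lebesgue Q = ennreal V" "emeasure \<sigma> Q = ennreal (W Q powr s * V)"
    "ennreal (W Q * V) \<le> ennreal C * mass Q" "Q \<in> sets lebesgue" "mass Q \<le> ennreal (W Q * V)"
proof -
  obtain a r where Q: "Q = qcube a r" "r > 0" using assms by (auto simp: cubes_eq_qcube)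
  define V where "V = (2 * r) ^ CARD('n)"
  have V: "V > 0" "emeasure lebesgue Q = ennreal V" using Q by (auto simp: V_def emeasure_qcube)
  have Qs: "Q \<in> sets lebesgue" using Q by simp
  have \<sigma>: "emeasure \<sigma> Q = ennreal (W Q powr s * V)"
    using W_eq[OF assms] V Qs by (simp add: emeasure_\<sigma> ennreal_mult)
  have "mass Q \<le> ennreal ((W Q powr s * V) powr (1 / s) * V powr (1 - 1 / s))"
    using Qs \<sigma> V by (intro mass_le) auto
  also have "(W Q powr s * V) powr (1 / s) * V powr (1 - 1 / s) = W Q * V"
    using W_pos[OF assms] V s by (simp add: powr_mult powr_powr powr_add[symmetric] mult.assoc)
  finally have "mass Q \<le> ennreal (W Q * V)" .
  then show ?thesis using that V Qs \<sigma> W_le[OF assms] W_pos[OF assms] by (auto simp: ennreal_mult mass_def)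
qed

text \<open>By Hoelder's inequality and the reverse Hoelder inequality, a part of \<open>Q\<close> of small relative
  Lebesgue measure \<open>\<eta>\<close> carries at most the proportion \<open>C \<eta>\<^bsup>1-1/s\<^esup>\<close> of the weight of \<open>Q\<close>. For \<open>\<theta>\<close> close to
  1 this applies to the shell between \<open>Q\<close> and its dilate by \<open>\<theta>\<close>.\<close>

lemma mass_shrink: "\<exists>\<theta>. 0 < \<theta> \<and> \<theta> < 1 \<and> (\<forall>a r. 0 < r \<longrightarrow> mass (qcube a r) \<le> 2 * mass (qcube a (\<theta> * r)))"
proof -
  define \<eta> where "\<eta> = min (1/2) ((1 / (2 * C)) powr (1 / (1 - 1 / s)))"
  have \<eta>: "0 < \<eta>" "\<eta> < 1" using C by (auto simp: \<eta>_def)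
  have "\<eta> powr (1 - 1 / s) \<le> ((1 / (2 * C)) powr (1 / (1 - 1 / s))) powr (1 - 1 / s)"
    using \<eta> s by (intro powr_mono2) (auto simp: \<eta>_def)
  also have "\<dots> = 1 / (2 * C)" using C s by (simp add: powr_powr)
  finally have \<eta>C: "\<eta> powr (1 - 1 / s) \<le> 1 / (2 * C)" .
  define \<theta> where "\<theta> = root CARD('n) (1 - \<eta>)"
  have \<theta>: "0 < \<theta>" "\<theta> < 1" "\<theta> ^ CARD('n) = 1 - \<eta>" using \<eta> by (auto simp: \<theta>_def)
  have "mass (qcube a r) \<le> 2 * mass (qcube a (\<theta> * r))" if r: "r > 0" for a r
  proof -
    let ?Q = "qcube a r" and ?Q' = "qcube a (\<theta> * r)"
    have Qc: "?Q \<in> cubes" using r by (rule qcube_in_cubes)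
    obtain V where V: "V > 0" "emeasure lebesgue ?Q = ennreal V" "emeasure \<sigma> ?Q = ennreal (W ?Q powr s * V)"
      "ennreal (W ?Q * V) \<le> ennreal C * mass ?Q" "mass ?Q \<le> ennreal (W ?Q * V)"
      using cube_facts[OF Qc] by metis
    have sub: "?Q' \<subseteq> ?Q" using \<theta> r by (intro qcube_mono) auto
    have "V = (2 * r) ^ CARD('n)" using V r by (simp add: emeasure_qcube)
    then have V': "emeasure lebesgue ?Q' = ennreal ((1 - \<eta>) * V)"
      using \<theta> r by (simp add: emeasure_qcube power_mult_distrib mult_ac)
    have "emeasure lebesgue (?Q - ?Q') = emeasure lebesgue ?Q - emeasure lebesgue ?Q'"
      using sub V' by (intro emeasure_Diff) auto
    also have "\<dots> = ennreal (\<eta> * V)"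
      using V V' \<eta> by (simp add: ennreal_minus algebra_simps)
    finally have D: "emeasure lebesgue (?Q - ?Q') = ennreal (\<eta> * V)" .
    have D\<sigma>: "emeasure \<sigma> (?Q - ?Q') \<le> ennreal (W ?Q powr s * V)"
      unfolding V(3)[symmetric] by (intro emeasure_mono) auto
    have "mass (?Q - ?Q') \<le> ennreal ((W ?Q powr s * V) powr (1 / s) * (\<eta> * V) powr (1 - 1 / s))"
      using V \<eta> D D\<sigma> by (intro mass_le) auto
    also have "(W ?Q powr s * V) powr (1 / s) * (\<eta> * V) powr (1 - 1 / s) = \<eta> powr (1 - 1 / s) * (W ?Q * V)"
    proof -
      have "V powr (1 / s) * V powr (1 - 1 / s) = V" using V by (simp add: powr_add[symmetric])
      then show ?thesis using W_pos[OF Qc] V \<eta> s by (simp add: powr_mult powr_powr mult_ac)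
    qed
    also have "\<dots> \<le> 1 / (2 * C) * (W ?Q * V)"
      using \<eta>C W_pos[OF Qc] V by (intro mult_right_mono) auto
    finally have "mass (?Q - ?Q') \<le> ennreal (1 / (2 * C) * (W ?Q * V))"
      by (simp add: ennreal_leI)
    also have "\<dots> = ennreal (1 / (2 * C)) * ennreal (W ?Q * V)"
      using C W_pos[OF Qc] V by (subst ennreal_mult[symmetric]) auto
    also have "\<dots> \<le> ennreal (1 / (2 * C)) * (ennreal C * mass ?Q)"
      using V by (intro mult_left_mono) auto
    also have "\<dots> = ennreal (1 / 2) * mass ?Q"
      using C by (simp add: mult.assoc[symmetric] ennreal_mult[symmetric])
    finally have 1: "mass (?Q - ?Q') \<le> ennreal (1 / 2) * mass ?Q" .
    have "mass ?Q \<le> mass ?Q' + mass (?Q - ?Q')"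
      using mass_Un_le[of ?Q' "?Q - ?Q'"] sub by (simp add: Un_absorb1)
    also have "\<dots> \<le> mass ?Q' + ennreal (1 / 2) * mass ?Q" using 1 by (rule add_left_mono)
    finally have 2: "mass ?Q \<le> mass ?Q' + ennreal (1 / 2) * mass ?Q" .
    have "mass ?Q' \<le> mass ?Q" using sub by (rule mass_mono)
    then obtain x y where xy: "mass ?Q = ennreal x" "x \<ge> 0" "mass ?Q' = ennreal y" "y \<ge> 0"
      using V(5) by (cases "mass ?Q"; cases "mass ?Q'") (auto simp: top_unique)
    have "ennreal y + ennreal (1 / 2) * ennreal x = ennreal (y + 1 / 2 * x)"
      using xy(2,4) by (subst ennreal_mult[symmetric], simp, simp, subst ennreal_plus) auto
    then have "ennreal x \<le> ennreal (y + 1 / 2 * x)" using 2 unfolding xy(1,3) by simp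
    then have "x \<le> 2 * y" using xy(2,4) by (subst (asm) ennreal_le_iff) auto
    then have "ennreal x \<le> ennreal (2 * y)" by (rule ennreal_leI)
    then show ?thesis unfolding xy(1,3) by (simp add: ennreal_mult')
  qed
  then show ?thesis using \<theta> by blast
qed

text \<open>Iterating the comparison of nearby concentric cubes compares \<open>w\<close> on \<open>Q\<close> and \<open>3 Q\<close>; since
  the plain and the \<open>L\<^sup>s\<close> averages of \<open>w\<close> are comparable, the same holds for \<open>w\<^sup>s\<close>.\<close>

lemma \<sigma>_doubling: "\<exists>D>0. \<forall>a r. 0 < r \<longrightarrow> emeasure \<sigma> (qcube a (3 * r)) \<le> ennreal D * emeasure \<sigma> (qcube a r)"
proof -
  obtain \<theta> where \<theta>: "0 < \<theta>" "\<theta> < 1"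
    and shrink: "\<And>a r. 0 < r \<Longrightarrow> mass (qcube a r) \<le> 2 * mass (qcube a (\<theta> * r))"
    using mass_shrink by blast
  have iter: "mass (qcube a r) \<le> 2 ^ m * mass (qcube a (\<theta> ^ m * r))" if "r > 0" for a r m
  proof (induction m)
    case (Suc m)
    have "mass (qcube a r) \<le> 2 ^ m * mass (qcube a (\<theta> ^ m * r))" by (rule Suc)
    also have "\<dots> \<le> 2 ^ m * (2 * mass (qcube a (\<theta> * (\<theta> ^ m * r))))"
      using \<theta> that by (intro mult_left_mono shrink) auto
    finally show ?case by (simp add: mult_ac)
  qed simp
  obtain m where m: "\<theta> ^ m < 1 / 3" using real_arch_pow_inv[of "1/3" \<theta>] \<theta> by auto
  define D where "D = (C * 2 ^ m) powr s * 3 ^ CARD('n)"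
  have "emeasure \<sigma> (qcube a (3 * r)) \<le> ennreal D * emeasure \<sigma> (qcube a r)" if r: "r > 0" for a r
  proof -
    let ?Q = "qcube a r" and ?R = "qcube a (3 * r)"
    have Qc: "?Q \<in> cubes" "?R \<in> cubes" using r by (auto intro: qcube_in_cubes)
    obtain V where V: "V > 0" "emeasure lebesgue ?Q = ennreal V" "emeasure \<sigma> ?Q = ennreal (W ?Q powr s * V)"
      "mass ?Q \<le> ennreal (W ?Q * V)"
      using cube_facts[OF Qc(1)] by metis
    obtain U where U: "U > 0" "emeasure lebesgue ?R = ennreal U" "emeasure \<sigma> ?R = ennreal (W ?R powr s * U)"
      "ennreal (W ?R * U) \<le> ennreal C * mass ?R"
      using cube_facts[OF Qc(2)] by metis
    have "V = (2 * r) ^ CARD('n)" "U = (2 * (3 * r)) ^ CARD('n)" using V U r by (auto simp: emeasure_qcube)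
    then have UV: "U = 3 ^ CARD('n) * V" by (metis mult.left_commute power_mult_distrib)
    have "mass ?R \<le> 2 ^ m * mass (qcube a (\<theta> ^ m * (3 * r)))" using r by (intro iter) auto
    also have "\<dots> \<le> 2 ^ m * mass ?Q"
      using m r by (intro mult_left_mono mass_mono qcube_mono) auto
    also have "\<dots> \<le> 2 ^ m * ennreal (W ?Q * V)" using V by (intro mult_left_mono) auto
    finally have "ennreal C * mass ?R \<le> ennreal C * (2 ^ m * ennreal (W ?Q * V))" by (intro mult_left_mono) auto
    with U(4) have "ennreal (W ?R * U) \<le> ennreal C * (2 ^ m * ennreal (W ?Q * V))" by (rule order_trans)
    also have "\<dots> = ennreal (C * 2 ^ m * (W ?Q * V))"
      using C V W_pos[OF Qc(1)] by (simp add: ennreal_mult ennreal_power[symmetric] mult_ac)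
    finally have "W ?R * U \<le> C * 2 ^ m * (W ?Q * V)"
      using C V W_pos[OF Qc(1)] by (subst (asm) ennreal_le_iff) auto
    moreover have "W ?R * V \<le> W ?R * U" using W_pos[OF Qc(2)] V UV by (simp add: mult_le_cancel_left1)
    ultimately have "W ?R * V \<le> (C * 2 ^ m * W ?Q) * V" by simp
    then have "W ?R \<le> C * 2 ^ m * W ?Q" using V by simp
    then have "W ?R powr s \<le> (C * 2 ^ m * W ?Q) powr s" using W_pos[OF Qc(2)] s by (intro powr_mono2) auto
    also have "\<dots> = (C * 2 ^ m) powr s * W ?Q powr s" using C W_pos[OF Qc(1)] by (simp add: powr_mult)
    finally have "W ?R powr s * U \<le> (C * 2 ^ m) powr s * W ?Q powr s * U"
      using U by (intro mult_right_mono) auto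
    also have "\<dots> = D * (W ?Q powr s * V)" by (simp add: D_def UV)
    finally show ?thesis unfolding V(3) U(3) using V by (simp add: D_def ennreal_mult[symmetric])
  qed
  moreover have "D > 0" using C by (simp add: D_def)
  ultimately show ?thesis by blast
qed

text \<open>The part of \<open>Q\<close> where \<open>w\<close> is not much larger than its \<open>L\<^sup>s\<close> average. The threshold is chosen
  so that the rest carries at most half of what the reverse Hoelder inequality guarantees.\<close>

definition core :: "(real ^ 'n) set \<Rightarrow> (real ^ 'n) set"
  where "core Q = {x\<in>Q. w x \<le> (2 * C) powr (1 / (s - 1)) * W Q}"

lemma core_sets: "Q \<in> sets lebesgue \<Longrightarrow> core Q \<in> sets lebesgue"
proof -
  assume [measurable]: "Q \<in> sets lebesgue"
  have "core Q = {x\<in>space lebesgue. w x \<le> (2 * C) powr (1 / (s - 1)) * W Q} \<inter> Q" by (auto simp: core_def)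
  also have "\<dots> \<in> sets lebesgue" by measurable
  finally show ?thesis .
qed

text \<open>Off the core, \<open>w\<close> is at most \<open>1/(2 C)\<close> times \<open>(W Q)\<^bsup>1-s\<^esup> w\<^sup>s\<close>. So a fixed proportion of
  \<open>\<integral> w\<close> over \<open>Q\<close> comes from the core, and Hoelder's inequality on the core turns this into a lower
  bound for \<open>\<integral> w\<^sup>s\<close>.\<close>

lemma core_large:
  assumes Q: "Q \<in> cubes"
  shows "ennreal ((2 * C) powr (- s)) * emeasure \<sigma> Q \<le> emeasure \<sigma> (core Q)"
proof -
  obtain V where V: "V > 0" "emeasure lebesgue Q = ennreal V" "emeasure \<sigma> Q = ennreal (W Q powr s * V)"
    "ennreal (W Q * V) \<le> ennreal C * mass Q" and [measurable]: "Q \<in> sets lebesgue"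
    using cube_facts[OF Q] by metis
  have W: "W Q > 0" using Q by (rule W_pos)
  have [measurable]: "core Q \<in> sets lebesgue" by (rule core_sets) measurable
  define K where "K = (2 * C) powr (1 / (s - 1))"
  have K: "K > 0" "K powr (1 - s) = 1 / (2 * C)"
  proof -
    have "1 / (s - 1) * (1 - s) = -1" using s by (simp add: field_simps)
    then show "K powr (1 - s) = 1 / (2 * C)" using C by (simp add: K_def powr_powr powr_minus inverse_eq_divide)
  qed (use C in \<open>simp add: K_def\<close>)
  have sub: "core Q \<subseteq> Q" by (auto simp: core_def)
  then have "emeasure \<sigma> (core Q) \<le> emeasure \<sigma> Q" "emeasure lebesgue (core Q) \<le> emeasure lebesgue Q"
    by (auto intro: emeasure_mono)
  then obtain x where x: "x \<ge> 0" "emeasure \<sigma> (core Q) = ennreal x"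
    using V by (cases "emeasure \<sigma> (core Q)") (auto simp: top_unique)
  have in_core: "mass (core Q) \<le> ennreal (x powr (1 / s) * V powr (1 - 1 / s))"
    using x V \<open>emeasure lebesgue (core Q) \<le> emeasure lebesgue Q\<close> by (intro mass_le) auto
  have "mass (Q - core Q) \<le> (\<integral>\<^sup>+z. ennreal ((K * W Q) powr (1 - s)) * (ennreal (w z powr s) * indicator Q z) \<partial>lebesgue)"
    unfolding mass_def
  proof (rule nn_integral_mono)
    fix z show "ennreal (w z) * indicator (Q - core Q) z \<le> ennreal ((K * W Q) powr (1 - s)) * (ennreal (w z powr s) * indicator Q z)"
    proof (cases "z \<in> Q - core Q")
      case True
      then have "K * W Q < w z" by (auto simp: core_def K_def)
      then have "w z powr (1 - s) \<le> (K * W Q) powr (1 - s)" using K W s by (intro powr_mono2') auto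
      then have "w z powr (1 - s) * w z powr s \<le> (K * W Q) powr (1 - s) * w z powr s" by (rule mult_right_mono) simp
      moreover have "w z powr (1 - s) * w z powr s = w z" using w_pos[of z] by (simp add: powr_add[symmetric])
      ultimately show ?thesis using True by (simp add: ennreal_mult[symmetric] ennreal_leI)
    qed simp
  qed
  also have "\<dots> = ennreal ((K * W Q) powr (1 - s)) * emeasure \<sigma> Q"
    by (simp add: nn_integral_cmult emeasure_\<sigma>)
  also have "\<dots> = ennreal (1 / (2 * C) * (W Q * V))"
  proof -
    have "W Q powr (1 - s) * W Q powr s = W Q" using W by (simp add: powr_add[symmetric])
    then have "(K * W Q) powr (1 - s) * (W Q powr s * V) = 1 / (2 * C) * (W Q * V)"
      using K W by (simp add: powr_mult mult_ac)
    then show ?thesis unfolding V(3) using V by (simp add: ennreal_mult[symmetric])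
  qed
  finally have off_core: "mass (Q - core Q) \<le> ennreal (1 / (2 * C) * (W Q * V))" .
  have "mass Q \<le> mass (core Q) + mass (Q - core Q)"
    using mass_Un_le[of "core Q" "Q - core Q"] sub by (simp add: Un_absorb1)
  also have "\<dots> \<le> ennreal (x powr (1 / s) * V powr (1 - 1 / s)) + ennreal (1 / (2 * C) * (W Q * V))"
    using in_core off_core by (rule add_mono)
  finally have "ennreal C * mass Q \<le> ennreal C * (ennreal (x powr (1 / s) * V powr (1 - 1 / s)) + ennreal (1 / (2 * C) * (W Q * V)))"
    by (rule mult_left_mono) simp
  with V(4) have "ennreal (W Q * V) \<le> ennreal C * (ennreal (x powr (1 / s) * V powr (1 - 1 / s)) + ennreal (1 / (2 * C) * (W Q * V)))"
    by (rule order_trans)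
  also have "\<dots> = ennreal (C * (x powr (1 / s) * V powr (1 - 1 / s)) + W Q * V / 2)"
    using C V W by (subst ennreal_plus[symmetric]) (auto simp: ennreal_mult[symmetric] distrib_left)
  finally have "W Q * V \<le> C * (x powr (1 / s) * V powr (1 - 1 / s)) + W Q * V / 2"
    using C V W by (subst (asm) ennreal_le_iff) auto
  then have "W Q * V \<le> 2 * C * (x powr (1 / s) * V powr (1 - 1 / s))" by simp
  moreover have "V = V powr (1 / s) * V powr (1 - 1 / s)" using V by (simp add: powr_add[symmetric])
  ultimately have "(W Q * V powr (1 / s)) * V powr (1 - 1 / s) \<le> (2 * C * x powr (1 / s)) * V powr (1 - 1 / s)"
    by (simp add: mult_ac)
  then have "W Q * V powr (1 / s) \<le> 2 * C * x powr (1 / s)" using V by simp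
  then have "(W Q * V powr (1 / s)) powr s \<le> (2 * C * x powr (1 / s)) powr s"
    using W s by (intro powr_mono2) auto
  then have "W Q powr s * V \<le> (2 * C) powr s * x"
    using W V C x s by (simp add: powr_mult powr_powr)
  then have "(2 * C) powr (- s) * (W Q powr s * V) \<le> x"
    using C by (simp add: powr_minus field_simps)
  then show ?thesis unfolding V(3) x(2) using V by (simp add: ennreal_mult[symmetric] ennreal_leI)
qed

lemma \<sigma>_vitali: "\<exists>D>0. \<forall>I. \<forall>Q :: nat \<Rightarrow> (real ^ 'n) set.
  finite I \<longrightarrow> (\<forall>k. Q k \<in> cubes) \<longrightarrow> vitali_family \<sigma> D I Q"
proof -
  obtain D where D: "D > 0"
    and dbl: "\<And>a r. 0 < r \<Longrightarrow> emeasure \<sigma> (qcube a (3 * r)) \<le> ennreal D * emeasure \<sigma> (qcube a r)"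
    using \<sigma>_doubling by blast
  have "vitali_family \<sigma> D I Q" if I: "finite I" and Q: "\<And>k. Q k \<in> cubes" for I and Q :: "nat \<Rightarrow> (real ^ 'n) set"
    unfolding vitali_family_def
  proof (intro conjI ballI allI impI)
    fix k assume "k \<in> I"
    obtain V where "V > 0" "emeasure \<sigma> (Q k) = ennreal (W (Q k) powr s * V)" "Q k \<in> sets lebesgue"
      using cube_facts[OF Q[of k]] by metis
    then show "Q k \<in> sets \<sigma>" "0 < emeasure \<sigma> (Q k)" "emeasure \<sigma> (Q k) < \<infinity>"
      using W_pos[OF Q[of k]] by auto
  next
    fix J assume J: "J \<subseteq> I"
    have "\<forall>k. \<exists>a r. Q k = qcube a r \<and> 0 < r" using Q by (auto simp: cubes_eq_qcube)
    then obtain a r where Qk: "\<And>k. Q k = qcube (a k) (r k)" and r: "\<And>k. 0 < r k" by metis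
    have "finite J" using J I by (rule finite_subset)
    then obtain J' where J': "J' \<subseteq> J" "disjoint_family_on Q J'"
      and cov: "(\<Union>k\<in>J. Q k) \<subseteq> (\<Union>k\<in>J'. qcube (a k) (3 * r k))"
      using qcube_Vitali_covering[of J a r] by (auto simp: Qk[abs_def])
    have finJ': "finite J'" using J' \<open>finite J\<close> finite_subset by blast
    have "emeasure \<sigma> (\<Union>k\<in>J. Q k) \<le> emeasure \<sigma> (\<Union>k\<in>J'. qcube (a k) (3 * r k))"
      using cov finJ' by (intro emeasure_mono) auto
    also have "\<dots> \<le> (\<Sum>k\<in>J'. emeasure \<sigma> (qcube (a k) (3 * r k)))"
      using finJ' by (intro emeasure_subadditive_finite) auto
    also have "\<dots> \<le> (\<Sum>k\<in>J'. ennreal D * emeasure \<sigma> (Q k))"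
      unfolding Qk by (intro sum_mono dbl r)
    finally show "\<exists>J'\<subseteq>J. disjoint_family_on Q J' \<and> emeasure \<sigma> (\<Union>k\<in>J. Q k) \<le> ennreal D * (\<Sum>k\<in>J'. emeasure \<sigma> (Q k))"
      using J' by (auto simp: sum_distrib_left)
  qed (use I D in auto)
  then show ?thesis using D by blast
qed

end

section \<open>From weights to measures\<close>

context reverse_Holder_weight begin

text \<open>The change of measure. With \<open>\<phi> = w\<^bsup>-1/(q-p)\<^esup>\<close> and \<open>d\<sigma> = w\<^sup>s dx\<close>, the choice \<open>s = q/(q-p)\<close> makes
  \<open>\<phi>\<^sup>q d\<sigma> = dx\<close> and \<open>\<phi>\<^sup>p d\<sigma> = w dx\<close>. Thus \<open>u k = v k \<cdot> \<phi>\<close> turns unweighted \<open>L\<^sup>q\<close> averages of \<open>v k\<close> into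
  averages for \<open>\<sigma>\<close>, up to the factor \<open>(W Q)\<^bsup>-1/(q-p)\<^esup>\<close>, and weighted \<open>L\<^sup>p\<close> norms into norms of
  \<open>L\<^sup>p(\<sigma>)\<close>. On the core of \<open>Q\<close> that factor is at most a constant times \<open>\<phi>\<close>.\<close>

lemma finite_weighted_estimate:
  assumes q: "1 < q" and p: "0 < p" "p < q" and s_eq: "s = q / (q - p)"
  obtains K where "K > 0"
    and "\<And>I N (Q :: nat \<Rightarrow> (real ^ 'n) set) v \<alpha>.
      finite I \<Longrightarrow> (\<And>k. Q k \<in> cubes) \<Longrightarrow> (\<And>k. v k \<in> borel_measurable lebesgue) \<Longrightarrow>
      (\<And>k x. 0 \<le> v k x) \<Longrightarrow> (\<And>k x. v k x * w x powr (- 1 / (q - p)) \<le> N) \<Longrightarrow>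
      (\<And>k x. x \<notin> Q k \<Longrightarrow> v k x = 0) \<Longrightarrow> (\<And>k. 0 \<le> \<alpha> k) \<Longrightarrow>
      (\<And>k. (\<integral>\<^sup>+x. ennreal (v k x powr q) \<partial>lebesgue) \<le> ennreal (\<alpha> k powr q) * emeasure lebesgue (Q k)) \<Longrightarrow>
      (\<integral>\<^sup>+x. ennreal ((\<Sum>k\<in>I. v k x) powr p) * ennreal (w x) \<partial>lebesgue)
        \<le> ennreal K * (\<integral>\<^sup>+x. ennreal ((\<Sum>k\<in>I. \<alpha> k * indicator (Q k) x) powr p) * ennreal (w x) \<partial>lebesgue)"
proof -
  obtain D where D: "D > 0" and vitali: "\<And>I (Q :: nat \<Rightarrow> (real ^ 'n) set).
      finite I \<Longrightarrow> (\<And>k. Q k \<in> cubes) \<Longrightarrow> vitali_family \<sigma> D I Q"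
    using \<sigma>_vitali by blast
  define c where "c = (2 * C) powr (- s)"
  have c: "c > 0" using C by (simp add: c_def)
  define e where "e = 1 / (q - p)"
  have e: "e > 0" "s = q * e" "s - p * e = 1"
    using p by (auto simp: e_def s_eq diff_divide_distrib[symmetric])
  define K0 where "K0 = ((2 * C) powr (1 / (s - 1))) powr e"
  have K0: "K0 > 0" using C by (simp add: K0_def)
  define \<phi> where "\<phi> x = w x powr (- e)" for x
  have [measurable]: "\<phi> \<in> borel_measurable lebesgue" unfolding \<phi>_def[abs_def] by measurable
  have \<phi>: "\<phi> x > 0" for x using w_pos[of x] by (simp add: \<phi>_def)
  have \<phi>q: "\<phi> x powr q * w x powr s = 1" for x
    using w_pos[of x] by (simp add: \<phi>_def powr_powr powr_add[symmetric] e(2) mult.commute)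
  have \<phi>p: "\<phi> x powr p * w x powr s = w x" for x
    using w_pos[of x] e(3) by (simp add: \<phi>_def powr_powr powr_add[symmetric] mult.commute)
  have int_\<sigma>: "(\<integral>\<^sup>+x. ennreal (h x) \<partial>\<sigma>) = (\<integral>\<^sup>+x. ennreal (h x * w x powr s) \<partial>lebesgue)"
    if [measurable]: "h \<in> borel_measurable lebesgue" and "\<And>x. 0 \<le> h x" for h
    unfolding \<sigma>_def using that by (subst nn_integral_density) (auto simp: ennreal_mult mult.commute)
  have main: "(\<integral>\<^sup>+x. ennreal ((\<Sum>k\<in>I. v k x) powr p) * ennreal (w x) \<partial>lebesgue)
      \<le> ennreal (block_const D c p q * K0 powr p)
        * (\<integral>\<^sup>+x. ennreal ((\<Sum>k\<in>I. \<alpha> k * indicator (Q k) x) powr p) * ennreal (w x) \<partial>lebesgue)"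
    if I: "finite I" and Q: "\<And>k. Q k \<in> cubes" and v_meas: "\<And>k. v k \<in> borel_measurable lebesgue"
      and v: "\<And>k x. 0 \<le> v k x" "\<And>k x. v k x * w x powr (- 1 / (q - p)) \<le> N"
      and supp: "\<And>k x. x \<notin> Q k \<Longrightarrow> v k x = 0" and \<alpha>: "\<And>k. 0 \<le> \<alpha> k"
      and size: "\<And>k. (\<integral>\<^sup>+x. ennreal (v k x powr q) \<partial>lebesgue) \<le> ennreal (\<alpha> k powr q) * emeasure lebesgue (Q k)"
    for I N \<alpha> and Q :: "nat \<Rightarrow> (real ^ 'n) set" and v
  proof -
    note [measurable] = v_meas
    define u where "u k x = v k x * \<phi> x" for k x
    define b where "b k = W (Q k) powr (- e) * \<alpha> k" for k
    have W: "W (Q k) > 0" for k using Q by (rule W_pos)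
    have Q_sets [measurable]: "Q k \<in> sets lebesgue" for k using cube_facts[OF Q] by blast
    have "block_family \<sigma> D c q I Q (\<lambda>k. core (Q k)) u b N"
    proof
      show "vitali_family \<sigma> D I Q" using I Q by (rule vitali)
      fix k
      show "core (Q k) \<in> sets \<sigma>" by (simp add: core_sets)
      show "core (Q k) \<subseteq> Q k" by (auto simp: core_def)
      show "ennreal c * emeasure \<sigma> (Q k) \<le> emeasure \<sigma> (core (Q k))"
        unfolding c_def using Q by (rule core_large)
      show "u k \<in> borel_measurable \<sigma>" unfolding u_def[abs_def] \<sigma>_def by measurable
      fix x
      show "0 \<le> u k x" using v(1) \<phi> by (simp add: u_def less_imp_le)
      show "u k x \<le> N" using v(2)[of k x] by (simp add: u_def \<phi>_def e_def)
      show "x \<notin> Q k \<Longrightarrow> u k x = 0" using supp by (simp add: u_def)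
      show "0 \<le> b k" using \<alpha> by (simp add: b_def)
    next
      fix k
      have "(\<integral>\<^sup>+x. ennreal (u k x powr q) \<partial>\<sigma>) = (\<integral>\<^sup>+x. ennreal (u k x powr q * w x powr s) \<partial>lebesgue)"
        unfolding u_def by (rule int_\<sigma>) auto
      also have "\<dots> = (\<integral>\<^sup>+x. ennreal (v k x powr q) \<partial>lebesgue)"
        using v(1) \<phi> by (simp add: u_def powr_mult less_imp_le mult.assoc \<phi>q)
      also have "\<dots> \<le> ennreal (\<alpha> k powr q) * emeasure lebesgue (Q k)" by (rule size)
      also have "\<dots> = ennreal (b k powr q) * emeasure \<sigma> (Q k)"
      proof -
        obtain V where V: "V > 0" "emeasure lebesgue (Q k) = ennreal V" "emeasure \<sigma> (Q k) = ennreal (W (Q k) powr s * V)"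
          using cube_facts[OF Q] by metis
        have "b k powr q * W (Q k) powr s = \<alpha> k powr q * (W (Q k) powr (- e * q) * W (Q k) powr s)"
          unfolding b_def using \<alpha> by (simp add: powr_mult powr_powr mult_ac)
        also have "W (Q k) powr (- e * q) * W (Q k) powr s = 1"
          using W[of k] by (simp add: powr_add[symmetric] e(2) mult.commute)
        finally have "b k powr q * W (Q k) powr s * V = \<alpha> k powr q * V" by simp
        then show ?thesis unfolding V(2,3) using V(1) by (simp add: ennreal_mult[symmetric] mult.assoc)
      qed
      finally show "(\<integral>\<^sup>+x. ennreal (u k x powr q) \<partial>\<sigma>) \<le> ennreal (b k powr q) * emeasure \<sigma> (Q k)" .
    qed (use c q in auto)
    then interpret B: block_family \<sigma> D c q I Q "\<lambda>k. core (Q k)" u b N .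
    define h where "h x = (\<Sum>k\<in>I. \<alpha> k * indicator (Q k) x)" for x
    have [measurable]: "h \<in> borel_measurable lebesgue" unfolding h_def[abs_def] by measurable
    have h0: "h x \<ge> 0" for x unfolding h_def using \<alpha> by (intro sum_nonneg) auto
    have G_eq: "B.G x = (\<Sum>k\<in>I. v k x) * \<phi> x" for x
      by (simp add: B.G_def u_def sum_distrib_right)
    have F_le: "B.F x \<le> K0 * \<phi> x * h x" for x
      unfolding B.F_def h_def sum_distrib_left
    proof (rule sum_mono)
      fix k
      show "b k * indicator (core (Q k)) x \<le> K0 * \<phi> x * (\<alpha> k * indicator (Q k) x)"
      proof (cases "x \<in> core (Q k)")
        case True
        then have "w x \<le> (2 * C) powr (1 / (s - 1)) * W (Q k)" and xQ: "x \<in> Q k" by (auto simp: core_def)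
        then have "((2 * C) powr (1 / (s - 1)) * W (Q k)) powr (- e) \<le> \<phi> x"
          unfolding \<phi>_def using w_pos[of x] e by (intro powr_mono2') auto
        then have "K0 * (((2 * C) powr (1 / (s - 1))) powr (- e) * W (Q k) powr (- e)) \<le> K0 * \<phi> x"
          using K0 C W[of k] by (simp add: powr_mult)
        moreover have "K0 * ((2 * C) powr (1 / (s - 1))) powr (- e) = 1"
          unfolding K0_def using C by (simp add: powr_add[symmetric])
        ultimately have "W (Q k) powr (- e) \<le> K0 * \<phi> x" by (simp add: mult.assoc[symmetric])
        then have "W (Q k) powr (- e) * \<alpha> k \<le> K0 * \<phi> x * \<alpha> k" using \<alpha> by (rule mult_right_mono)
        then show ?thesis using True xQ by (simp add: b_def)
      next
        case False
        then show ?thesis using K0 \<phi>[of x] \<alpha>[of k] by simp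
      qed
    qed
    have "(\<integral>\<^sup>+x. ennreal ((\<Sum>k\<in>I. v k x) powr p) * ennreal (w x) \<partial>lebesgue) = (\<integral>\<^sup>+x. ennreal (B.G x powr p * w x powr s) \<partial>lebesgue)"
    proof (rule nn_integral_cong)
      fix x
      have "B.G x powr p * w x powr s = (\<Sum>k\<in>I. v k x) powr p * (\<phi> x powr p * w x powr s)"
        unfolding G_eq using v(1) \<phi>[of x] by (subst powr_mult) (auto intro: sum_nonneg)
      then show "ennreal ((\<Sum>k\<in>I. v k x) powr p) * ennreal (w x) = ennreal (B.G x powr p * w x powr s)"
        using w_pos[of x] by (simp add: \<phi>p ennreal_mult)
    qed
    also have "\<dots> = (\<integral>\<^sup>+x. ennreal (B.G x powr p) \<partial>\<sigma>)"
      using B.G_meas by (intro int_\<sigma>[symmetric]) (auto simp: measurable_cong_sets[OF sets_\<sigma> refl])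
    also have "\<dots> \<le> ennreal (block_const D c p q) * (\<integral>\<^sup>+x. ennreal (B.F x powr p) \<partial>\<sigma>)"
      using p by (rule B.estimate)
    also have "\<dots> \<le> ennreal (block_const D c p q) * (\<integral>\<^sup>+x. ennreal (K0 powr p) * ennreal ((\<phi> x * h x) powr p) \<partial>\<sigma>)"
    proof (intro mult_left_mono nn_integral_mono)
      fix x
      have "B.F x powr p \<le> (K0 * (\<phi> x * h x)) powr p"
        using F_le[of x] B.F_nonneg[of x] p by (intro powr_mono2) (auto simp: mult.assoc)
      also have "\<dots> = K0 powr p * (\<phi> x * h x) powr p"
        using K0 h0[of x] \<phi>[of x] by (subst powr_mult) auto
      finally show "ennreal (B.F x powr p) \<le> ennreal (K0 powr p) * ennreal ((\<phi> x * h x) powr p)"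
        by (simp add: ennreal_mult[symmetric] ennreal_leI)
    qed auto
    also have "\<dots> = ennreal (block_const D c p q) * (ennreal (K0 powr p) * (\<integral>\<^sup>+x. ennreal ((\<phi> x * h x) powr p * w x powr s) \<partial>lebesgue))"
      by (subst nn_integral_cmult, simp add: \<sigma>_def, subst int_\<sigma>) auto
    also have "\<dots> = ennreal (block_const D c p q) * (ennreal (K0 powr p) * (\<integral>\<^sup>+x. ennreal (h x powr p) * ennreal (w x) \<partial>lebesgue))"
    proof -
      have "ennreal ((\<phi> x * h x) powr p * w x powr s) = ennreal (h x powr p) * ennreal (w x)" for x
      proof -
        have "(\<phi> x * h x) powr p * w x powr s = h x powr p * (\<phi> x powr p * w x powr s)"
          using h0[of x] \<phi>[of x] by (subst powr_mult) auto
        then show ?thesis using w_pos[of x] by (simp add: \<phi>p ennreal_mult)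
      qed
      then show ?thesis by simp
    qed
    also have "\<dots> = ennreal (block_const D c p q * K0 powr p) * (\<integral>\<^sup>+x. ennreal (h x powr p) * ennreal (w x) \<partial>lebesgue)"
      using block_const_pos[OF c D p q] by (simp add: ennreal_mult mult.assoc)
    finally show ?thesis unfolding h_def .
  qed
  have "block_const D c p q * K0 powr p > 0" using block_const_pos[OF c D p q] K0 by simp
  then show thesis by (rule that[OF _ main])
qed

end

section \<open>Powers on the extended half-line and truncation\<close>

lemma epowr_mono: "0 < a \<Longrightarrow> x \<le> y \<Longrightarrow> epowr x a \<le> epowr y a"
  by (auto simp: epowr_def top_unique intro!: ennreal_leI powr_mono2 enn2real_mono simp: less_top)

lemma epowr_ennreal: "0 \<le> x \<Longrightarrow> epowr (ennreal x) a = ennreal (x powr a)"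
  by (simp add: epowr_def)

lemma epowr_epowr: "epowr (epowr x a) b = epowr x (a * b)"
  by (auto simp: epowr_def powr_powr)

lemma epowr_1 [simp]: "epowr x 1 = x"
  by (cases x) (auto simp: epowr_def)

lemma epowr_mult_ennreal: "0 < c \<Longrightarrow> epowr (ennreal c * x) a = ennreal (c powr a) * epowr x a"
  by (cases x) (auto simp: epowr_def ennreal_mult[symmetric] enn2real_mult powr_mult ennreal_mult_top)

lemma epowr_measurable [measurable]: "(\<lambda>x. epowr x a) \<in> borel_measurable borel"
  unfolding epowr_def by measurable

text \<open>Monotone functions only satisfy the opposite inequality in general; here the inverse power
  is monotone as well.\<close>

lemma epowr_SUP_le:
  assumes "0 < a" shows "epowr (SUP n. f n) a \<le> (SUP n. epowr (f n) a)"
proof -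
  define S where "S = (SUP n. epowr (f n) a)"
  have "f n \<le> epowr S (1 / a)" for n
  proof -
    have "f n = epowr (epowr (f n) a) (1 / a)" using assms by (simp add: epowr_epowr)
    also have "\<dots> \<le> epowr S (1 / a)" unfolding S_def using assms by (intro epowr_mono SUP_upper) auto
    finally show ?thesis .
  qed
  then have "epowr (SUP n. f n) a \<le> epowr (epowr S (1 / a)) a"
    using assms by (intro epowr_mono SUP_least) auto
  then show ?thesis using assms by (simp add: epowr_epowr S_def)
qed

text \<open>Truncating the number of terms and their heights at once exhausts a series of non-negative
  terms, and leaves finite sums of finite terms.\<close>

lemma suminf_le_SUP_truncated:
  fixes f :: "nat \<Rightarrow> ennreal"
  assumes t: "0 < t"
  shows "(\<Sum>k. f k) \<le> (SUP n. \<Sum>k<n. min (f k) (ennreal (real n * t)))"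
proof -
  define H where "H n = (\<Sum>k<n. min (f k) (ennreal (real n * t)))" for n
  have "(\<Sum>k<m. f k) \<le> (SUP n. H n)" for m
  proof (rule LIMSEQ_le_const2)
    have "filterlim (\<lambda>n. real n * t) at_top sequentially"
      using t by (intro filterlim_at_top_mult_tendsto_pos[OF tendsto_const] filterlim_real_sequentially)
    then have "(\<lambda>n. ennreal (real n * t)) \<longlonglongrightarrow> \<infinity>"
      by (simp add: ennreal_tendsto_top_eq_at_top)
    then have "(\<lambda>n. \<Sum>k<m. min (f k) (ennreal (real n * t))) \<longlonglongrightarrow> (\<Sum>k<m. min (f k) \<infinity>)"
      by (intro tendsto_sum tendsto_min tendsto_const)
    then show "(\<lambda>n. \<Sum>k<m. min (f k) (ennreal (real n * t))) \<longlonglongrightarrow> (\<Sum>k<m. f k)" by simp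
    have "(\<Sum>k<m. min (f k) (ennreal (real n * t))) \<le> (SUP n. H n)" if "m \<le> n" for n
    proof -
      have "(\<Sum>k<m. min (f k) (ennreal (real n * t))) \<le> H n"
        unfolding H_def using that by (intro sum_mono2) auto
      also have "\<dots> \<le> (SUP n. H n)" by (rule SUP_upper) simp
      finally show ?thesis .
    qed
    then show "\<exists>n0. \<forall>n\<ge>n0. (\<Sum>k<m. min (f k) (ennreal (real n * t))) \<le> (SUP n. H n)" by blast
  qed
  then show ?thesis unfolding H_def[symmetric] by (simp add: suminf_eq_SUP SUP_le_iff)
qed

section \<open>The weighted inequality\<close>

text \<open>Local integrability of the weight and the reverse Hoelder inequality make all averages of
  \<open>w\<^sup>s\<close> over cubes finite, so that the norms of the class can be expressed by real numbers.\<close>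

lemma RH_real_representative:
  fixes w :: "real ^ 'n \<Rightarrow> ennreal"
  assumes "weight w" and "w \<in> RH s" and s: "s > 1"
  obtains w' C W where "reverse_Holder_weight w' s C W" and "AE x in lebesgue. w x = ennreal (w' x)"
proof -
  have w_meas [measurable]: "w \<in> borel_measurable lebesgue" and w_loc: "\<And>K. compact K \<Longrightarrow> (\<integral>\<^sup>+x\<in>K. w x \<partial>lebesgue) < \<infinity>"
    and w_AE: "AE x in lebesgue. 0 < w x \<and> w x < \<infinity>"
    using assms(1) by (auto simp: weight_def)
  obtain C where C: "C > 0"
    and RH: "\<And>Q. Q \<in> cubes \<Longrightarrow> epowr (avg Q (\<lambda>x. epowr (w x) s)) (1 / s) \<le> ennreal C * avg Q w"
    using assms(2) by (auto simp: RH_def)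
  \<comment> \<open>The value 1 on the exceptional null set keeps negative powers of \<open>w'\<close> meaningful.\<close>
  define w' where "w' x = (if 0 < w x \<and> w x < \<infinity> then enn2real (w x) else 1)" for x
  have [measurable]: "w' \<in> borel_measurable lebesgue" unfolding w'_def[abs_def] by measurable
  have w'_pos: "w' x > 0" for x by (auto simp: w'_def enn2real_positive_iff)
  have w'_AE: "AE x in lebesgue. w x = ennreal (w' x)"
    using w_AE by eventually_elim (auto simp: w'_def)
  define W where "W Q = enn2real (epowr (avg Q (\<lambda>x. epowr (w x) s)) (1 / s))" for Q
  have weight_cube: "0 < W Q"
      "(\<integral>\<^sup>+x. ennreal (w' x powr s) * indicator Q x \<partial>lebesgue) = ennreal (W Q powr s) * emeasure lebesgue Q"
      "ennreal (W Q) * emeasure lebesgue Q \<le> ennreal C * (\<integral>\<^sup>+x. ennreal (w' x) * indicator Q x \<partial>lebesgue)"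
    if Q: "Q \<in> cubes" for Q :: "(real ^ 'n) set"
  proof -
    obtain a r where Qr: "Q = qcube a r" "r > 0" using Q by (auto simp: cubes_eq_qcube)
    then have [measurable]: "Q \<in> sets lebesgue" by simp
    obtain V where V: "V > 0" "emeasure lebesgue Q = ennreal V"
      using emeasure_qcube[of r a] Qr that[of "(2 * r) ^ CARD('n)"] by auto
    have ws: "(\<integral>\<^sup>+x\<in>Q. epowr (w x) s \<partial>lebesgue) = (\<integral>\<^sup>+x. ennreal (w' x powr s) * indicator Q x \<partial>lebesgue)"
      using w'_AE by (intro nn_integral_cong_AE, eventually_elim) (simp add: epowr_ennreal w'_pos less_imp_le)
    have w1: "(\<integral>\<^sup>+x\<in>Q. w x \<partial>lebesgue) = (\<integral>\<^sup>+x. ennreal (w' x) * indicator Q x \<partial>lebesgue)"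
      using w'_AE by (intro nn_integral_cong_AE, eventually_elim) simp
    have times_V: "x / ennreal V * ennreal V = x" for x :: ennreal
      using V by (simp add: ennreal_divide_times ennreal_times_divide[symmetric] divide_ennreal)
    have "(\<integral>\<^sup>+x\<in>Q. w x \<partial>lebesgue) < \<infinity>" using Qr by (intro w_loc) (auto simp: qcube_def)
    then have "avg Q w < \<infinity>" using V by (auto simp: avg_def less_top[symmetric] ennreal_divide_eq_top_iff)
    then have "ennreal C * avg Q w < \<infinity>" by (simp add: ennreal_mult_less_top)
    then have "epowr (avg Q (\<lambda>x. epowr (w x) s)) (1 / s) < \<infinity>" using RH[OF Q] by (rule le_less_trans[rotated])
    then obtain A where A: "A \<ge> 0" "avg Q (\<lambda>x. epowr (w x) s) = ennreal A"
      by (cases "avg Q (\<lambda>x. epowr (w x) s)") (auto simp: epowr_def)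
    have WA: "W Q = A powr (1 / s)" using A by (simp add: W_def epowr_ennreal)
    have int: "(\<integral>\<^sup>+x. ennreal (w' x powr s) * indicator Q x \<partial>lebesgue) = ennreal A * ennreal V"
      using A(2) V ws times_V by (metis avg_def)
    \<comment> \<open>If the average vanished, positivity of \<open>w'\<close> would make the cube a null set.\<close>
    have "A \<noteq> 0"
    proof
      assume "A = 0"
      then have "(\<integral>\<^sup>+x. ennreal (w' x powr s) * indicator Q x \<partial>lebesgue) = 0" using int by simp
      then have "AE x in lebesgue. ennreal (w' x powr s) * indicator Q x = 0"
        by (subst (asm) nn_integral_0_iff_AE) auto
      then have "AE x in lebesgue. x \<notin> Q"
        by eventually_elim (use w'_pos in \<open>auto simp: indicator_def split: if_splits dest: less_imp_neq[symmetric]\<close>)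
      then have "emeasure lebesgue Q = 0"
        by (simp add: AE_iff_measurable[OF \<open>Q \<in> sets lebesgue\<close>])
      then show False using V by simp
    qed
    then show "0 < W Q" using A by (simp add: WA)
    show "(\<integral>\<^sup>+x. ennreal (w' x powr s) * indicator Q x \<partial>lebesgue) = ennreal (W Q powr s) * emeasure lebesgue Q"
      unfolding int V(2) WA using A s by (simp add: powr_powr)
    have "ennreal (W Q) = epowr (avg Q (\<lambda>x. epowr (w x) s)) (1 / s)" using A by (simp add: WA epowr_ennreal)
    then have "ennreal (W Q) * ennreal V \<le> ennreal C * avg Q w * ennreal V"
      using RH[OF Q] by (intro mult_right_mono) auto
    also have "\<dots> = ennreal C * (\<integral>\<^sup>+x\<in>Q. w x \<partial>lebesgue)"
      using times_V by (simp add: avg_def V mult.assoc)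
    finally show "ennreal (W Q) * emeasure lebesgue Q \<le> ennreal C * (\<integral>\<^sup>+x. ennreal (w' x) * indicator Q x \<partial>lebesgue)"
      unfolding V(2) w1 .
  qed
  have "reverse_Holder_weight w' s C W"
    by unfold_locales (use w'_pos s C weight_cube in auto)
  then show thesis using w'_AE by (rule that)
qed

theorem lemma4p7:
  fixes p q :: real and w :: "real ^ 'n \<Rightarrow> ennreal"
  assumes "q > 1" and "0 < p" and "p < q"
    and "weight w" and "w \<in> RH (conj_exponent (q / p))"
  shows "\<exists>C::real. C > 0 \<and>
    (\<forall>(Q :: nat \<Rightarrow> (real ^ 'n) set) (g :: nat \<Rightarrow> real ^ 'n \<Rightarrow> ennreal).
      (\<forall>k. Q k \<in> cubes) \<longrightarrow>
      (\<forall>k. g k \<in> borel_measurable lebesgue) \<longrightarrow>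
      (\<forall>k. closure {x. g k x \<noteq> 0} \<subseteq> Q k) \<longrightarrow>
      Lp_norm p w (\<lambda>x. \<Sum>k. g k x)
        \<le> ennreal C *
          Lp_norm p w (\<lambda>x. \<Sum>k. epowr (avg (Q k) (\<lambda>y. epowr (g k y) q)) (1 / q) * indicator (Q k) x))"
proof -
  define s where "s = conj_exponent (q / p)"
  have s_eq: "s = q / (q - p)" using assms by (simp add: s_def conj_exponent_def field_simps)
  have s: "s > 1" using assms by (simp add: s_eq field_simps)
  have [measurable]: "w \<in> borel_measurable lebesgue" using assms(4) by (simp add: weight_def)
  obtain w' C W where R: "reverse_Holder_weight w' s C W" and w'_AE: "AE x in lebesgue. w x = ennreal (w' x)"
    using RH_real_representative[OF assms(4) _ s] assms(5) unfolding s_def by metis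
  interpret R: reverse_Holder_weight w' s C W by (rule R)
  have w'_pos: "w' x > 0" for x by (rule R.w_pos)
  have [measurable]: "w' \<in> borel_measurable lebesgue" by (rule R.w_meas)
  show ?thesis
  proof (rule R.finite_weighted_estimate[OF assms(1-3) s_eq], goal_cases)
    case (1 K)
    note K = 1(1) and est = 1(2)
    have "Lp_norm p w (\<lambda>x. \<Sum>k. g k x) \<le> ennreal (K powr (1 / p)) *
        Lp_norm p w (\<lambda>x. \<Sum>k. epowr (avg (Q k) (\<lambda>y. epowr (g k y) q)) (1 / q) * indicator (Q k) x)"
      if Q: "\<And>k. Q k \<in> cubes" and g_meas: "\<And>k. g k \<in> borel_measurable lebesgue"
        and supp: "\<And>k. closure {x. g k x \<noteq> 0} \<subseteq> Q k"
      for Q :: "nat \<Rightarrow> (real ^ 'n) set" and g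
    proof -
      note [measurable] = g_meas
      define F where "F x = (\<Sum>k. epowr (avg (Q k) (\<lambda>y. epowr (g k y) q)) (1 / q) * indicator (Q k) x)" for x
      \<comment> \<open>The \<open>n\<close>-th truncation is at height \<open>n t\<close>: then both \<open>v n k\<close> and its product with the power
        of \<open>w'\<close> that occurs in the change of measure are at most \<open>n\<close>. The first bound makes the
        averages finite, the second one is the bound on blocks.\<close>
      define t where "t x = min 1 (w' x powr (1 / (q - p)))" for x
      have [measurable]: "t \<in> borel_measurable lebesgue" unfolding t_def[abs_def] by measurable
      have t: "0 < t x" "t x \<le> 1" "t x * w' x powr (- 1 / (q - p)) \<le> 1" for x
      proof -
        show "0 < t x" "t x \<le> 1" using w'_pos[of x] by (auto simp: t_def)
        have "t x * w' x powr (- 1 / (q - p)) \<le> w' x powr (1 / (q - p)) * w' x powr (- 1 / (q - p))"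
          by (intro mult_right_mono) (auto simp: t_def)
        also have "\<dots> = 1" using w'_pos[of x] by (simp add: powr_add[symmetric])
        finally show "t x * w' x powr (- 1 / (q - p)) \<le> 1" .
      qed
      define v where "v n k x = enn2real (min (g k x) (ennreal (real n * t x)))" for n k x
      have v_meas [measurable]: "v n k \<in> borel_measurable lebesgue" for n k
        unfolding v_def[abs_def] by measurable
      have v_ennreal: "ennreal (v n k x) = min (g k x) (ennreal (real n * t x))" for n k x
      proof -
        have "min (g k x) (ennreal (real n * t x)) < \<infinity>" by (simp add: min_less_iff_disj)
        then show ?thesis by (simp add: v_def)
      qed
      have v0: "0 \<le> v n k x" for n k x by (simp add: v_def)
      have v_le: "v n k x \<le> real n * t x" for n k x
      proof -
        have "ennreal (v n k x) \<le> ennreal (real n * t x)" by (simp add: v_ennreal)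
        then show ?thesis using t(1)[of x] by (subst (asm) ennreal_le_iff) auto
      qed
      have v_supp: "v n k x = 0" if "x \<notin> Q k" for n k x
      proof -
        have "g k x = 0" using supp[of k] that closure_subset[of "{x. g k x \<noteq> 0}"] by auto
        then show ?thesis by (simp add: v_def)
      qed
      have truncated: "(\<integral>\<^sup>+x. epowr (\<Sum>k<n. min (g k x) (ennreal (real n * t x))) p * w x \<partial>lebesgue)
          \<le> ennreal K * (\<integral>\<^sup>+x. epowr (F x) p * w x \<partial>lebesgue)" for n
      proof -
        \<comment> \<open>\<open>\<alpha>\<close> is the \<open>L\<^sup>q\<close> average of the truncated function.\<close>
        have ex: "\<exists>\<alpha>\<ge>0. (\<integral>\<^sup>+x. ennreal (v n k x powr q) \<partial>lebesgue) = ennreal (\<alpha> powr q) * emeasure lebesgue (Q k)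
          \<and> ennreal \<alpha> \<le> epowr (avg (Q k) (\<lambda>y. epowr (g k y) q)) (1 / q)" for k
        proof -
          obtain V where V: "V > 0" "emeasure lebesgue (Q k) = ennreal V" and [measurable]: "Q k \<in> sets lebesgue"
            using R.cube_facts[OF Q] by metis
          have v_on_Q: "(\<integral>\<^sup>+x. ennreal (v n k x powr q) \<partial>lebesgue) = (\<integral>\<^sup>+x. ennreal (v n k x powr q) * indicator (Q k) x \<partial>lebesgue)"
            using v_supp by (intro nn_integral_cong) (auto simp: indicator_def)
          also have "\<dots> \<le> (\<integral>\<^sup>+x. ennreal (real n powr q) * indicator (Q k) x \<partial>lebesgue)"
          proof (intro nn_integral_mono mult_right_mono ennreal_leI powr_mono2)
            fix x
            have "real n * t x \<le> real n * 1" using t(2)[of x] by (intro mult_left_mono) auto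
            then show "v n k x \<le> real n" using v_le[of n k x] by simp
          qed (use assms v0 in auto)
          also have "\<dots> < \<infinity>" using V by (simp add: nn_integral_cmult_indicator ennreal_mult_less_top)
          finally obtain A where A: "A \<ge> 0" "(\<integral>\<^sup>+x. ennreal (v n k x powr q) \<partial>lebesgue) = ennreal A"
            by (cases "(\<integral>\<^sup>+x. ennreal (v n k x powr q) \<partial>lebesgue)") auto
          define \<alpha> where "\<alpha> = (A / V) powr (1 / q)"
          have \<alpha>q: "\<alpha> powr q = A / V" using assms A V by (simp add: \<alpha>_def powr_powr)
          have "(\<integral>\<^sup>+x. ennreal (v n k x powr q) \<partial>lebesgue) \<le> (\<integral>\<^sup>+x\<in>Q k. epowr (g k x) q \<partial>lebesgue)"
            unfolding v_on_Q
          proof (intro nn_integral_mono mult_right_mono)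
            fix x
            have "ennreal (v n k x powr q) = epowr (ennreal (v n k x)) q" using v0 by (simp add: epowr_ennreal)
            also have "\<dots> \<le> epowr (g k x) q" using assms by (intro epowr_mono) (auto simp: v_ennreal)
            finally show "ennreal (v n k x powr q) \<le> epowr (g k x) q" .
          qed auto
          then have "ennreal (A / V) \<le> avg (Q k) (\<lambda>y. epowr (g k y) q)"
            using A V by (simp add: avg_def divide_ennreal[symmetric] divide_right_mono_ennreal)
          then have "epowr (ennreal (A / V)) (1 / q) \<le> epowr (avg (Q k) (\<lambda>y. epowr (g k y) q)) (1 / q)"
            using assms by (intro epowr_mono) auto
          then have "ennreal \<alpha> \<le> epowr (avg (Q k) (\<lambda>y. epowr (g k y) q)) (1 / q)"
            using A V by (simp add: \<alpha>_def epowr_ennreal)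
          moreover have "ennreal A = ennreal (\<alpha> powr q) * ennreal V"
            using A V by (simp add: \<alpha>q ennreal_mult[symmetric])
          ultimately show ?thesis using A V by (intro exI[of _ \<alpha>]) (auto simp: \<alpha>_def)
        qed
        obtain \<alpha> where \<alpha>0: "\<And>k. 0 \<le> \<alpha> k"
          and \<alpha>: "\<And>k. (\<integral>\<^sup>+x. ennreal (v n k x powr q) \<partial>lebesgue) = ennreal (\<alpha> k powr q) * emeasure lebesgue (Q k)"
          and \<alpha>_le: "\<And>k. ennreal (\<alpha> k) \<le> epowr (avg (Q k) (\<lambda>y. epowr (g k y) q)) (1 / q)"
          using ex by metis
        have "(\<integral>\<^sup>+x. epowr (\<Sum>k<n. min (g k x) (ennreal (real n * t x))) p * w x \<partial>lebesgue)
          = (\<integral>\<^sup>+x. ennreal ((\<Sum>k<n. v n k x) powr p) * ennreal (w' x) \<partial>lebesgue)"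
          using w'_AE
        proof (intro nn_integral_cong_AE, eventually_elim)
          case (elim x)
          have "(\<Sum>k<n. min (g k x) (ennreal (real n * t x))) = ennreal (\<Sum>k<n. v n k x)"
            unfolding v_ennreal[symmetric] using v0 by (intro sum_ennreal) auto
          then show ?case using elim v0 by (simp add: epowr_ennreal sum_nonneg)
        qed
        also have "\<dots> \<le> ennreal K * (\<integral>\<^sup>+x. ennreal ((\<Sum>k<n. \<alpha> k * indicator (Q k) x) powr p) * ennreal (w' x) \<partial>lebesgue)"
        proof (rule est[where N = "real n"])
          fix k x
          have "v n k x * w' x powr (- 1 / (q - p)) \<le> real n * t x * w' x powr (- 1 / (q - p))"
            by (intro mult_right_mono v_le) auto
          also have "\<dots> \<le> real n * 1" unfolding mult.assoc using t(3)[of x] by (intro mult_left_mono) auto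
          finally show "v n k x * w' x powr (- 1 / (q - p)) \<le> real n" by simp
        qed (use Q v0 v_supp \<alpha>0 \<alpha> in auto)
        also have "\<dots> \<le> ennreal K * (\<integral>\<^sup>+x. epowr (F x) p * w x \<partial>lebesgue)"
        proof (intro mult_left_mono nn_integral_mono_AE)
          show "AE x in lebesgue. ennreal ((\<Sum>k<n. \<alpha> k * indicator (Q k) x) powr p) * ennreal (w' x) \<le> epowr (F x) p * w x"
            using w'_AE
          proof eventually_elim
            case (elim x)
            have "ennreal (\<Sum>k<n. \<alpha> k * indicator (Q k) x) = (\<Sum>k<n. ennreal (\<alpha> k) * indicator (Q k) x)"
              using \<alpha>0 by (subst sum_ennreal[symmetric]) (auto simp: indicator_def intro!: sum.cong)
            also have "\<dots> \<le> (\<Sum>k<n. epowr (avg (Q k) (\<lambda>y. epowr (g k y) q)) (1 / q) * indicator (Q k) x)"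
              by (intro sum_mono mult_right_mono \<alpha>_le) auto
            also have "\<dots> \<le> F x" unfolding F_def by (intro sum_le_suminf) auto
            finally have "epowr (ennreal (\<Sum>k<n. \<alpha> k * indicator (Q k) x)) p \<le> epowr (F x) p"
              using assms by (intro epowr_mono) auto
            moreover have "0 \<le> (\<Sum>k<n. \<alpha> k * indicator (Q k) x)" using \<alpha>0 by (intro sum_nonneg) auto
            ultimately show ?case using elim by (simp add: epowr_ennreal mult_right_mono)
          qed
        qed auto
        finally show ?thesis .
      qed
      define H where "H n x = (\<Sum>k<n. min (g k x) (ennreal (real n * t x)))" for n x
      have H_mono: "H m x \<le> H n x" if "m \<le> n" for m n x
      proof -
        have "real m * t x \<le> real n * t x" using that t(1)[of x] by (intro mult_right_mono) auto
        then have "H m x \<le> (\<Sum>k<m. min (g k x) (ennreal (real n * t x)))"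
          unfolding H_def by (intro sum_mono min.mono ennreal_leI) auto
        also have "\<dots> \<le> H n x" unfolding H_def using that by (intro sum_mono2) auto
        finally show ?thesis .
      qed
      have [measurable]: "H n \<in> borel_measurable lebesgue" for n
        unfolding H_def[abs_def] by measurable
      have "(\<integral>\<^sup>+x. epowr (\<Sum>k. g k x) p * w x \<partial>lebesgue) \<le> (\<integral>\<^sup>+x. (SUP n. epowr (H n x) p * w x) \<partial>lebesgue)"
      proof (rule nn_integral_mono)
        fix x
        have "epowr (\<Sum>k. g k x) p \<le> epowr (SUP n. H n x) p"
          unfolding H_def using assms t(1) by (intro epowr_mono suminf_le_SUP_truncated)
        also have "\<dots> \<le> (SUP n. epowr (H n x) p)" using assms by (intro epowr_SUP_le)
        finally have "epowr (\<Sum>k. g k x) p * w x \<le> (SUP n. epowr (H n x) p) * w x" by (rule mult_right_mono) simp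
        then show "epowr (\<Sum>k. g k x) p * w x \<le> (SUP n. epowr (H n x) p * w x)"
          by (simp add: SUP_mult_right_ennreal)
      qed
      also have "\<dots> = (SUP n. \<integral>\<^sup>+x. epowr (H n x) p * w x \<partial>lebesgue)"
        using assms by (intro nn_integral_monotone_convergence_SUP)
          (auto simp: incseq_def le_fun_def intro!: mult_right_mono epowr_mono H_mono)
      also have "\<dots> \<le> ennreal K * (\<integral>\<^sup>+x. epowr (F x) p * w x \<partial>lebesgue)"
        unfolding H_def by (intro SUP_least truncated)
      finally have "epowr (\<integral>\<^sup>+x. epowr (\<Sum>k. g k x) p * w x \<partial>lebesgue) (1 / p)
          \<le> epowr (ennreal K * (\<integral>\<^sup>+x. epowr (F x) p * w x \<partial>lebesgue)) (1 / p)"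
        using assms by (intro epowr_mono) auto
      then show ?thesis using K by (simp add: Lp_norm_def F_def epowr_mult_ennreal)
    qed
    moreover have "K powr (1 / p) > 0" using K by simp
    ultimately show ?case by blast
  qed
qed

end
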